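(* Consider the networked dynamical system with connectivity matrix $\mathbf{G}=[g_{ij}]\in\mathbb{R}^{N\times N}$, $g_{ij}\ge 0$, $$\dot{\mathbf{x}}(t)=(I_N\otimes A+\mathbf{G}\otimes bc^T)\mathbf{x}(t)+(I_N\otimes b)\mathbf{w}(t),\qquad \mathbf{y}(t)=(I_N\otimes c^T)\mathbf{x}(t),$$ where $A\in\mathbb{R}^{n\times n}$, $b,c\in\mathbb{R}^n$, and $I_N\otimes A+\mathbf{G}\otimes bc^T$ is Hurwitz. Assume the inputs $w_1,\dots,w_N$ are uncorrelated zero-mean wide-sense stationary processes with identical autocorrelation function, hence common power spectral density $S_w(\omega)$, and that $S_w(\omega)>0$ for all $\omega\in(-\Omega,\Omega)$, where $\Omega>0$. Let $\mathbf{S}(\omega)=[S_{y_iy_j}(\omega)]$ be the $N\times N$ matrix of output cross-power spectral densities of this (ungrounded) system. For a node $j\in\{1,\dots,N\}$, let $\widetilde{\mathbf{S}}_j(\omega)=[\widetilde S_{y_iy_k}(\omega)]_{i,k\neq j}$ be the $(N-1)\times(N-1)$ matrix of output cross-power spectral densities of the dynamics grounded at node $j$, $$\dot{\widetilde{\mathbf{x}}}(t)=(I_{N-1}\otimes A+\widetilde{\mathbf{G}}_j\otimes bc^T)\widetilde{\mathbf{x}}(t)+(I_{N-1}\otimes b)\widetilde{\mathbf{w}}(t),\qquad \widetilde{\mathbf{y}}(t)=(I_{N-1}\otimes c^T)\widetilde{\mathbf{x}}(t),$$ where $\widetilde{\mathbf{w}}$ is $\mathbf{w}$ with its $j$-th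 entry removed and $\widetilde{\mathbf{G}}_j$ is $\mathbf{G}$ with its $j$-th row and column removed. Then, for any $\omega_0\in(-\Omega,\Omega)$, $$g_{ji}=\begin{cases}\left[S_w(\omega_0)\left([\mathbf{S}^{-1}(\omega_0)]_{ii}-[\widetilde{\mathbf{S}}_j^{-1}(\omega_0)]_{ii}\right)\right]^{1/2}, & \text{for } i<j,\\[4pt] \left[S_w(\omega_0)\left([\mathbf{S}^{-1}(\omega_0)]_{ii}-[\widetilde{\mathbf{S}}_j^{-1}(\omega_0)]_{i-1,i-1}\right)\right]^{1/2}, & \text{for } i>j.\end{cases}$$
   Context: $\otimes$ is the Kronecker product and $I_d$ the $d\times d$ identity matrix. $\mathbf{x}(t)\in\mathbb{R}^{Nn}$ is the network state, $\mathbf{w}(t)=(w_1(t),\dots,w_N(t))^T$ the input noise vector, and $\mathbf{y}(t)=(y_1(t),\dots,y_N(t))^T$ the output vector, all real stochastic processes. The cross-correlation is $R_{xy}(\tau)=\mathbb{E}(x(t)y(t-\tau))$, the cross-power spectral density $S_{xy}(\omega)$ is its Fourier transform, and the power spectral density is $S_x=S_{xx}$. Entries of $\widetilde{\mathbf{S}}_j$ are indexed $1,\dots,N-1$ following the order of the remaining nodes. *)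

theory Defs
  imports
    "HOL-Probability.Probability"
    "Jordan_Normal_Form.Char_Poly"
    "Jordan_Normal_Form.Gauss_Jordan_Elimination"
begin

unbundle no vec_syntax

section \<open>Second-order processes and spectral densities\<close>

text \<open>
  A scalar process is a function from time (the whole real line) and sample point to \<open>real\<close>;
  a vector process has values of type \<open>real vec\<close>.
\<close>

definition coord :: "(real \<Rightarrow> 'a \<Rightarrow> real vec) \<Rightarrow> nat \<Rightarrow> real \<Rightarrow> 'a \<Rightarrow> real" where
  "coord X i = (\<lambda>t \<omega>. X t \<omega> $ i)"

definition second_order :: "'a measure \<Rightarrow> (real \<Rightarrow> 'a \<Rightarrow> real) \<Rightarrow> bool" where
  "second_order P X \<longleftrightarrow>
     (\<forall>t. X t \<in> borel_measurable P \<and> integrable P (\<lambda>\<omega>. (X t \<omega>)\<^sup>2))"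

definition is_cross_correlation ::
  "'a measure \<Rightarrow> (real \<Rightarrow> 'a \<Rightarrow> real) \<Rightarrow> (real \<Rightarrow> 'a \<Rightarrow> real) \<Rightarrow> (real \<Rightarrow> real) \<Rightarrow> bool" where
  "is_cross_correlation P X Y R \<longleftrightarrow>
     (\<forall>t \<tau>. (\<integral>\<omega>. X t \<omega> * Y (t - \<tau>) \<omega> \<partial>P) = R \<tau>)"

definition zero_mean :: "'a measure \<Rightarrow> (real \<Rightarrow> 'a \<Rightarrow> real) \<Rightarrow> bool" where
  "zero_mean P X \<longleftrightarrow> (\<forall>t. (\<integral>\<omega>. X t \<omega> \<partial>P) = 0)"

definition uncorrelated ::
  "'a measure \<Rightarrow> (real \<Rightarrow> 'a \<Rightarrow> real) \<Rightarrow> (real \<Rightarrow> 'a \<Rightarrow> real) \<Rightarrow> bool" where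
  "uncorrelated P X Y \<longleftrightarrow>
     (\<forall>t s. (\<integral>\<omega>. X t \<omega> * Y s \<omega> \<partial>P) = (\<integral>\<omega>. X t \<omega> \<partial>P) * (\<integral>\<omega>. Y s \<omega> \<partial>P))"

definition wide_sense_stationary :: "'a measure \<Rightarrow> (real \<Rightarrow> 'a \<Rightarrow> real) \<Rightarrow> bool" where
  "wide_sense_stationary P X \<longleftrightarrow>
     second_order P X \<and>
     (\<exists>m. \<forall>t. (\<integral>\<omega>. X t \<omega> \<partial>P) = m) \<and>
     (\<exists>R. is_cross_correlation P X X R)"

definition jointly_wss :: "'a measure \<Rightarrow> nat \<Rightarrow> (real \<Rightarrow> 'a \<Rightarrow> real vec) \<Rightarrow> bool" where
  "jointly_wss P d X \<longleftrightarrow>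
     (\<forall>t. \<forall>\<omega>\<in>space P. X t \<omega> \<in> carrier_vec d) \<and>
     (\<forall>i<d. wide_sense_stationary P (coord X i)) \<and>
     (\<forall>i<d. \<forall>k<d. \<exists>R. is_cross_correlation P (coord X i) (coord X k) R)"

text \<open>
  \<open>has_cpsd P X Y S\<close>: the cross-correlation \<open>R\<close> of \<open>X\<close> and \<open>Y\<close> depends on the lag only,
  is Lebesgue integrable, and has \<open>S\<close> as its Fourier transform.  Integrability is part of
  the notion because the Bochner integral of a non-integrable function is 0.
\<close>

definition has_cpsd ::
  "'a measure \<Rightarrow> (real \<Rightarrow> 'a \<Rightarrow> real) \<Rightarrow> (real \<Rightarrow> 'a \<Rightarrow> real) \<Rightarrow> (real \<Rightarrow> complex) \<Rightarrow> bool" where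
  "has_cpsd P X Y S \<longleftrightarrow>
     second_order P X \<and> second_order P Y \<and>
     (\<exists>R. is_cross_correlation P X Y R \<and> integrable lborel R \<and>
        (\<forall>\<omega>. S \<omega> = (\<integral>\<tau>. exp (- \<i> * of_real (\<omega> * \<tau>)) * of_real (R \<tau>) \<partial>lborel)))"

definition has_psd :: "'a measure \<Rightarrow> (real \<Rightarrow> 'a \<Rightarrow> real) \<Rightarrow> (real \<Rightarrow> real) \<Rightarrow> bool" where
  "has_psd P X S \<longleftrightarrow> has_cpsd P X X (\<lambda>\<omega>. of_real (S \<omega>))"

definition has_cpsd_matrix ::
  "'a measure \<Rightarrow> nat \<Rightarrow> (real \<Rightarrow> 'a \<Rightarrow> real vec) \<Rightarrow> (real \<Rightarrow> complex mat) \<Rightarrow> bool" where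
  "has_cpsd_matrix P d Y S \<longleftrightarrow>
     (\<forall>\<omega>. S \<omega> \<in> carrier_mat d d) \<and>
     (\<forall>i<d. \<forall>k<d. has_cpsd P (coord Y i) (coord Y k) (\<lambda>\<omega>. S \<omega> $$ (i, k)))"


section \<open>Stationary responses of linear systems\<close>

text \<open>
  The time derivative of a process is taken in mean square, the usual notion for processes
  known through their correlations; it does not require sample paths to be differentiable,
  so noise with discontinuous paths is admitted as input.
\<close>

definition has_ms_derivative ::
  "'a measure \<Rightarrow> (real \<Rightarrow> 'a \<Rightarrow> real) \<Rightarrow> (real \<Rightarrow> 'a \<Rightarrow> real) \<Rightarrow> bool" where
  "has_ms_derivative P X D \<longleftrightarrow>
     second_order P X \<and> second_order P D \<and>
     (\<forall>t. ((\<lambda>h. \<integral>\<omega>. ((X (t + h) \<omega> - X t \<omega>) / h - D t \<omega>)\<^sup>2 \<partial>P) \<longlongrightarrow> 0) (at 0))"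

text \<open>
  \<open>x\<close> solves \<open>x' = F x + B w\<close> on the whole time line and is in its stationary regime: all
  coordinates of \<open>x\<close> and \<open>w\<close> are jointly wide-sense stationary, so that correlations
  between any of the signals depend on the lag only.
\<close>

definition stationary_response ::
  "'a measure \<Rightarrow> real mat \<Rightarrow> real mat \<Rightarrow> (real \<Rightarrow> 'a \<Rightarrow> real vec) \<Rightarrow> (real \<Rightarrow> 'a \<Rightarrow> real vec) \<Rightarrow> bool"
where
  "stationary_response P F B w x \<longleftrightarrow>
     (\<forall>t. \<forall>\<omega>\<in>space P. x t \<omega> \<in> carrier_vec (dim_row F) \<and> w t \<omega> \<in> carrier_vec (dim_col B)) \<and>
     jointly_wss P (dim_row F + dim_col B) (\<lambda>t \<omega>. x t \<omega> @\<^sub>v w t \<omega>) \<and>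
     (\<forall>i<dim_row F. has_ms_derivative P (coord x i)
        (coord (\<lambda>t \<omega>. F *\<^sub>v x t \<omega> + B *\<^sub>v w t \<omega>) i))"

definition hurwitz :: "real mat \<Rightarrow> bool" where
  "hurwitz F \<longleftrightarrow> (\<forall>z. eigenvalue (map_mat complex_of_real F) z \<longrightarrow> Re z < 0)"


section \<open>Networked systems\<close>

definition kronecker :: "real mat \<Rightarrow> real mat \<Rightarrow> real mat" (infixl \<open>\<otimes>\<^sub>K\<close> 70) where
  "A \<otimes>\<^sub>K B = mat (dim_row A * dim_row B) (dim_col A * dim_col B)
     (\<lambda>(i, j). A $$ (i div dim_row B, j div dim_col B) * B $$ (i mod dim_row B, j mod dim_col B))"

definition col_mat :: "real vec \<Rightarrow> real mat" where
  "col_mat v = mat_of_cols (dim_vec v) [v]"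

definition row_mat :: "real vec \<Rightarrow> real mat" where
  "row_mat v = mat_of_rows (dim_vec v) [v]"

definition network_mat :: "real mat \<Rightarrow> real vec \<Rightarrow> real vec \<Rightarrow> real mat \<Rightarrow> real mat" where
  "network_mat A b c G = 1\<^sub>m (dim_row G) \<otimes>\<^sub>K A + G \<otimes>\<^sub>K (col_mat b * row_mat c)"

definition network_response ::
  "'a measure \<Rightarrow> real mat \<Rightarrow> real vec \<Rightarrow> real vec \<Rightarrow> real mat \<Rightarrow>
   (real \<Rightarrow> 'a \<Rightarrow> real vec) \<Rightarrow> (real \<Rightarrow> 'a \<Rightarrow> real vec) \<Rightarrow> bool" where
  "network_response P A b c G w x \<longleftrightarrow>
     stationary_response P (network_mat A b c G) (1\<^sub>m (dim_row G) \<otimes>\<^sub>K col_mat b) w x"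

definition network_output ::
  "nat \<Rightarrow> real vec \<Rightarrow> (real \<Rightarrow> 'a \<Rightarrow> real vec) \<Rightarrow> real \<Rightarrow> 'a \<Rightarrow> real vec" where
  "network_output N c x = (\<lambda>t \<omega>. (1\<^sub>m N \<otimes>\<^sub>K row_mat c) *\<^sub>v x t \<omega>)"

text \<open>
  \<open>insert_index j\<close> enumerates the indices different from \<open>j\<close> in increasing order, as in
  \<open>mat_delete\<close>.
\<close>

definition drop_coord ::
  "nat \<Rightarrow> (real \<Rightarrow> 'a \<Rightarrow> real vec) \<Rightarrow> real \<Rightarrow> 'a \<Rightarrow> real vec" where
  "drop_coord j w = (\<lambda>t \<omega>. vec (dim_vec (w t \<omega>) - 1) (\<lambda>i. w t \<omega> $ insert_index j i))"

text \<open>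
  Only meaningful for invertible arguments; otherwise \<open>mat_inverse\<close> returns \<open>None\<close>.
\<close>

abbreviation matinv :: "complex mat \<Rightarrow> complex mat" where
  "matinv A \<equiv> the (mat_inverse A)"

end

theory Submission
  imports Defs "Jordan_Normal_Form.Spectral_Radius"
begin

text \<open>
  With \<open>p(s) = det (sI - A)\<close> and \<open>q(s) = c\<^sup>T adj (sI - A) b\<close>, eliminating the states from the
  equations of motion gives \<open>p y = q (w + G y)\<close>.  Applied to both arguments of the output
  correlations this becomes \<open>Q S Q\<^sup>* = |q|\<^sup>2 S\<^sub>w I\<close> at \<open>\<i>\<omega>\<close>, where \<open>Q = p I - q G\<close>, hence
  \<open>S\<^sup>-\<^sup>1 = Q\<^sup>* Q / (|q|\<^sup>2 S\<^sub>w)\<close>.  The same holds for the grounded network with the submatrix of \<open>Q\<close>,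
  so the difference of corresponding diagonal entries of the inverses is
  \<open>|Q\<^sub>j\<^sub>i|\<^sup>2 / (|q|\<^sup>2 S\<^sub>w) = g\<^sub>j\<^sub>i\<^sup>2 / S\<^sub>w\<close>.

  The grounded network need not be stable and the correlations of its states need not be
  integrable, so the elimination is not carried out on Fourier transforms.  Bounded correlations are
  integrated against the derivatives of a wide Gaussian window, where differentiation acts as
  a shift of the order of the derivative and the elimination is an exact polynomial identity.
  Only the integrable correlations, those of the outputs and of the inputs, remain in the final
  identity, and there the window can be removed.
\<close>

section \<open>Polynomials in the shift operator\<close>

text \<open>This is the action \<open>r(E) J\<close> with \<open>E\<close> the shift
  \<open>J \<mapsto> (\<lambda>k. J (Suc k))\<close>. It makes sequences a module over the
  polynomial ring, so that linear recurrences can be treated by polynomial matrix algebra.\<close>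

definition shift_poly :: "'a::comm_ring_1 poly \<Rightarrow> (nat \<Rightarrow> 'a) \<Rightarrow> nat \<Rightarrow> 'a" where
  "shift_poly r J k = (\<Sum>a\<le>degree r. coeff r a * J (a + k))"

lemma shift_poly_0 [simp]: "shift_poly 0 J k = 0"
  by (simp add: shift_poly_def)

lemma shift_poly_1 [simp]: "shift_poly 1 J k = J k"
  by (simp add: shift_poly_def)

lemma shift_poly_pCons [simp]:
  "shift_poly (pCons c r) J k = c * J k + shift_poly r J (Suc k)"
proof (cases "r = 0")
  case False
  then show ?thesis
    by (simp add: shift_poly_def sum.atMost_Suc_shift del: sum.atMost_Suc)
qed (simp add: shift_poly_def)

lemma shift_poly_add: "shift_poly (p + r) J k = shift_poly p J k + shift_poly r J k"
  by (induction p r arbitrary: k rule: poly_induct2) (simp_all add: algebra_simps)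

lemma shift_poly_smult: "shift_poly (Polynomial.smult c r) J k = c * shift_poly r J k"
  by (induction r arbitrary: k) (simp_all add: algebra_simps)

text \<open>The associative law of the module. It lets an identity between polynomial matrices be
  applied to sequences factor by factor.\<close>

lemma shift_poly_mult: "shift_poly (p * r) J k = shift_poly p (shift_poly r J) k"
  by (induction p arbitrary: k) (simp_all add: shift_poly_add shift_poly_smult)

lemma shift_poly_uminus: "shift_poly (- r) J k = - shift_poly r J k"
  using shift_poly_smult[of "-1" r J k] by simp

lemma shift_poly_diff: "shift_poly (p - r) J k = shift_poly p J k - shift_poly r J k"
  using shift_poly_add[of p "- r" J k] by (simp add: shift_poly_uminus)

lemma shift_poly_sum: "shift_poly (\<Sum>i\<in>I. p i) J k = (\<Sum>i\<in>I. shift_poly (p i) J k)"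
  by (induction I rule: infinite_finite_induct) (simp_all add: shift_poly_add)

lemma shift_poly_lincomb:
  "shift_poly r (\<lambda>k. \<Sum>i\<in>I. c i * J i k) k = (\<Sum>i\<in>I. c i * shift_poly r (J i) k)"
  unfolding shift_poly_def sum_distrib_left by (subst sum.swap) (simp add: ac_simps)

lemma shift_poly_sum_seq:
  "shift_poly r (\<lambda>k. \<Sum>i\<in>I. J i k) k = (\<Sum>i\<in>I. shift_poly r (J i) k)"
  using shift_poly_lincomb[where c = "\<lambda>_. 1"] by simp

lemma shift_poly_scale_seq: "shift_poly r (\<lambda>k. c * J k) k = c * shift_poly r J k"
  unfolding shift_poly_def by (simp add: sum_distrib_left ac_simps)

lemma shift_poly_add_seq:
  "shift_poly r (\<lambda>k. J k + J' k) k = shift_poly r J k + shift_poly r J' k"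
  unfolding shift_poly_def by (simp add: algebra_simps sum.distrib)

lemma shift_poly_diff_seq:
  "shift_poly r (\<lambda>k. J k - J' k) k = shift_poly r J k - shift_poly r J' k"
  unfolding shift_poly_def by (simp add: algebra_simps sum_subtractf)

text \<open>
  On the imaginary axis \<open>adjoint_poly r\<close> takes the conjugate values of \<open>r\<close>, whatever the
  coefficients of \<open>r\<close>.
\<close>

definition adjoint_poly :: "complex poly \<Rightarrow> complex poly" where
  "adjoint_poly r = map_poly cnj (r \<circ>\<^sub>p [:0, -1:])"

lemma adjoint_poly_0 [simp]: "adjoint_poly 0 = 0"
  by (simp add: adjoint_poly_def)

lemma adjoint_poly_pCons: "adjoint_poly (pCons c r) = pCons (cnj c) (- adjoint_poly r)"
  by (rule poly_eqI) (simp add: adjoint_poly_def pcompose_pCons coeff_map_poly coeff_pCons split: nat.split)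

lemma poly_adjoint_0: "poly (adjoint_poly r) 0 = cnj (poly r 0)"
  by (cases r) (simp add: adjoint_poly_pCons)

text \<open>Each shift of \<open>(-1) ^ a * cnj (J a)\<close> costs one sign, which
  \<open>adjoint_poly\<close> compensates on odd powers. Reversing the lag of a correlation acts on
  its damped transforms in exactly this way (\<open>damped_fourier_reflect\<close>), so equations
  can be carried over to the reversed correlation.\<close>

lemma shift_poly_adjoint:
  "shift_poly (adjoint_poly r) (\<lambda>a. (-1) ^ a * cnj (J a)) k = (-1) ^ k * cnj (shift_poly r J k)"
proof (induction r arbitrary: k)
  case (pCons c r)
  then show ?case
    by (simp add: adjoint_poly_pCons shift_poly_uminus algebra_simps)
qed simp

text \<open>This is \<open>c^T adj(X I - M) b\<close>, the numerator of the transfer function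
  \<open>c^T (X I - M)^(-1) b\<close> over the denominator \<open>char_poly M\<close>.\<close>

definition transfer_numerator :: "'a::comm_ring_1 mat \<Rightarrow> 'a vec \<Rightarrow> 'a vec \<Rightarrow> 'a poly" where
  "transfer_numerator M b c = (\<Sum>r<dim_row M. (\<Sum>s<dim_row M.
     [:c $ s:] * adj_mat (char_poly_matrix M) $$ (s, r)) * [:b $ r:])"

text \<open>Cramer's rule over the polynomial ring eliminates the state from the equation of motion.\<close>

lemma shift_poly_char_poly:
  assumes M: "M \<in> carrier_mat n n"
    and rec: "\<And>r a. r < n \<Longrightarrow> J r (Suc a) = (\<Sum>s<n. M $$ (r, s) * J s a) + b $ r * g a"
  shows "shift_poly (char_poly M) (\<lambda>a. \<Sum>s<n. c $ s * J s a) k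
    = shift_poly (transfer_numerator M b c) g k"
proof -
  define X where "X = char_poly_matrix M"
  define l where "l r = (\<Sum>s<n. [:c $ s:] * adj_mat X $$ (s, r))" for r
  have X: "X \<in> carrier_mat n n" using M by (simp add: X_def)
  note adj = adj_mat[OF X]
  \<comment> \<open>The row vector \<open>l\<close> is \<open>c^T adj(X)\<close>, so
    \<open>adj(X) X = det(X) I\<close> gives \<open>l X = det(X) c^T\<close>.\<close>
  have lX: "(\<Sum>r<n. l r * X $$ (r, s)) = char_poly M * [:c $ s:]" if s: "s < n" for s
  proof -
    have prod: "(\<Sum>r<n. adj_mat X $$ (t, r) * X $$ (r, s)) = (if t = s then char_poly M else 0)"
      if t: "t < n" for t
    proof -
      have "(\<Sum>r<n. adj_mat X $$ (t, r) * X $$ (r, s)) = (adj_mat X * X) $$ (t, s)"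
        using X adj(1) s t by (simp add: scalar_prod_def lessThan_atLeast0)
      also have "\<dots> = (if t = s then char_poly M else 0)"
        using s t by (subst adj(3)) (simp add: char_poly_def X_def)
      finally show ?thesis .
    qed
    have "(\<Sum>r<n. l r * X $$ (r, s)) = (\<Sum>t<n. [:c $ t:] * (\<Sum>r<n. adj_mat X $$ (t, r) * X $$ (r, s)))"
      unfolding l_def sum_distrib_left sum_distrib_right
      by (subst sum.swap) (simp add: mult.assoc)
    also have "\<dots> = (\<Sum>t<n. if t = s then [:c $ t:] * char_poly M else 0)"
      by (rule sum.cong) (simp_all add: prod)
    also have "\<dots> = char_poly M * [:c $ s:]"
      using s by simp
    finally show ?thesis .
  qed
  \<comment> \<open>The recurrence, read in the module, is the linear system
    \<open>X J = b g\<close>; multiplying it from the left by \<open>l\<close> eliminates the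
    state.\<close>
  have row: "(\<Sum>s<n. shift_poly (X $$ (r, s)) (J s) a) = b $ r * g a" if r: "r < n" for r a
  proof -
    have "shift_poly (X $$ (r, s)) (J s) a = (if s = r then J s (Suc a) else 0) - M $$ (r, s) * J s a"
      if "s < n" for s
      using M r that by (simp add: X_def char_poly_matrix_def)
    then have "(\<Sum>s<n. shift_poly (X $$ (r, s)) (J s) a)
        = (\<Sum>s<n. (if s = r then J s (Suc a) else 0) - M $$ (r, s) * J s a)"
      by simp
    also have "\<dots> = J r (Suc a) - (\<Sum>s<n. M $$ (r, s) * J s a)"
      using r by (simp add: sum_subtractf)
    finally show ?thesis using rec[OF r, of a] by simp
  qed
  have "shift_poly (char_poly M) (\<lambda>a. \<Sum>s<n. c $ s * J s a) k
      = (\<Sum>s<n. shift_poly (char_poly M * [:c $ s:]) (J s) k)"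
    by (simp add: shift_poly_lincomb shift_poly_smult)
  also have "\<dots> = (\<Sum>s<n. \<Sum>r<n. shift_poly (l r) (shift_poly (X $$ (r, s)) (J s)) k)"
    by (rule sum.cong) (simp_all flip: lX add: shift_poly_sum shift_poly_mult del: mult_pCons_right)
  also have "\<dots> = (\<Sum>r<n. shift_poly (l r) (\<lambda>a. \<Sum>s<n. shift_poly (X $$ (r, s)) (J s) a) k)"
    by (subst sum.swap) (simp add: shift_poly_sum_seq)
  also have "\<dots> = (\<Sum>r<n. b $ r * shift_poly (l r) g k)"
    by (rule sum.cong) (simp_all add: row shift_poly_scale_seq)
  also have "\<dots> = shift_poly (transfer_numerator M b c) g k"
    using M by (simp add: transfer_numerator_def shift_poly_sum shift_poly_smult
        l_def X_def mult.commute[of _ "[:_:]"] del: mult_pCons_right)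
  finally show ?thesis .
qed

section \<open>Gaussian-regularised Fourier integrals\<close>

lemma power_le_fact_mult_exp:
  assumes "0 \<le> (x::real)" shows "x ^ k \<le> fact k * exp x"
proof -
  have "(\<Sum>i\<in>{k}. x ^ i /\<^sub>R fact i) \<le> (\<Sum>i. x ^ i /\<^sub>R fact i)"
    using assms by (intro sum_le_suminf summable_exp_generic) auto
  then show ?thesis by (simp add: exp_def field_simps)
qed

lemma poly_gaussian_bounded:
  obtains C where "\<And>x::real. \<bar>poly p x * exp (- x\<^sup>2 / 2)\<bar> \<le> C"
proof
  fix x :: real
  have mono: "\<bar>x\<bar> ^ k * exp (- x\<^sup>2 / 2) \<le> fact k * exp (1/2)" for k
  proof -
    \<comment> \<open>Completing the square bounds the exponent
      \<open>\<bar>x\<bar> - x\<^sup>2 / 2\<close> by its maximum \<open>1/2\<close>, attained at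
      \<open>\<bar>x\<bar> = 1\<close>.\<close>
    have "0 \<le> (\<bar>x\<bar> - 1)\<^sup>2" by simp
    then have "\<bar>x\<bar> - x\<^sup>2 / 2 \<le> 1/2" by (simp add: power2_diff)
    then have "exp (\<bar>x\<bar>) * exp (- x\<^sup>2 / 2) \<le> exp (1/2)"
      by (simp flip: exp_add)
    moreover have "\<bar>x\<bar> ^ k * exp (- x\<^sup>2 / 2) \<le> fact k * exp \<bar>x\<bar> * exp (- x\<^sup>2 / 2)"
      by (intro mult_right_mono power_le_fact_mult_exp) auto
    ultimately show ?thesis
      by (smt (verit, best) fact_ge_zero mult.assoc mult_left_mono)
  qed
  have "\<bar>poly p x * exp (- x\<^sup>2 / 2)\<bar> \<le> (\<Sum>k\<le>degree p. \<bar>coeff p k\<bar> * (\<bar>x\<bar> ^ k * exp (- x\<^sup>2 / 2)))"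
    unfolding poly_altdef sum_distrib_right
    by (rule order_trans[OF sum_abs]) (simp add: abs_mult power_abs mult.assoc)
  also have "\<dots> \<le> (\<Sum>k\<le>degree p. \<bar>coeff p k\<bar> * (fact k * exp (1/2)))"
    by (intro sum_mono mult_left_mono mono) auto
  finally show "\<bar>poly p x * exp (- x\<^sup>2 / 2)\<bar> \<le> (\<Sum>k\<le>degree p. \<bar>coeff p k\<bar> * (fact k * exp (1/2)))" .
qed

text \<open>A linear combination of moments of the standard normal density, rescaled by
  \<open>sqrt (2 * pi)\<close>.\<close>

lemma poly_gaussian_integrable: "integrable lborel (\<lambda>x::real. poly p x * exp (- x\<^sup>2 / 2))"
proof -
  have "integrable lborel (\<lambda>x::real. \<Sum>k\<le>degree p. coeff p k * (sqrt (2 * pi) * (std_normal_density x * x ^ k)))"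
    by (intro Bochner_Integration.integrable_sum integrable_mult_right integrable_std_normal_moment)
  then show ?thesis
    by (simp add: poly_altdef sum_distrib_left std_normal_density_def ac_simps)
qed

text \<open>These are \<open>(-1)^a\<close> times the probabilists' Hermite polynomials; with this
  sign \<open>gaussian_deriv a\<close> is exactly the derivative of order \<open>a\<close> of
  \<open>exp (- x\<^sup>2 / 2)\<close>.\<close>

fun signed_hermite :: "nat \<Rightarrow> real poly" where
  "signed_hermite 0 = 1"
| "signed_hermite (Suc a) = pderiv (signed_hermite a) - pCons 0 (signed_hermite a)"

definition gaussian_deriv :: "nat \<Rightarrow> real \<Rightarrow> real" where
  "gaussian_deriv a x = poly (signed_hermite a) x * exp (- x\<^sup>2 / 2)"

lemma gaussian_deriv_DERIV:
  "(gaussian_deriv a has_real_derivative gaussian_deriv (Suc a) x) (at x)"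
  unfolding gaussian_deriv_def
  by (auto intro!: derivative_eq_intros simp: algebra_simps)

lemma gaussian_deriv_minus: "gaussian_deriv a (- x) = (-1) ^ a * gaussian_deriv a x"
proof -
  have "signed_hermite a \<circ>\<^sub>p [:0, -1:] = Polynomial.smult ((-1) ^ a) (signed_hermite a)"
  proof (induction a)
    case (Suc a)
    have "pderiv (signed_hermite a) \<circ>\<^sub>p [:0, -1:]
        = - pderiv (signed_hermite a \<circ>\<^sub>p [:0, -1:])"
      by (simp add: pderiv_pcompose pderiv_pCons)
    then show ?case
      by (simp add: pcompose_diff pcompose_pCons Suc pderiv_smult smult_diff_right)
  qed simp
  from arg_cong[where f = "\<lambda>p. poly p x", OF this] show ?thesis
    by (simp add: gaussian_deriv_def poly_pcompose)
qed

lemma gaussian_deriv_bounded: obtains C where "\<And>x. \<bar>gaussian_deriv a x\<bar> \<le> C"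
  using poly_gaussian_bounded unfolding gaussian_deriv_def by metis

text \<open>Multiplying by \<open>x\<close> leaves a polynomial times the Gaussian, which is
  bounded. This decay rate suffices to remove the boundary terms in the integration by
  parts.\<close>

lemma gaussian_deriv_decay:
  obtains C where "\<And>x. x \<noteq> 0 \<Longrightarrow> \<bar>gaussian_deriv a x\<bar> \<le> C / \<bar>x\<bar>"
proof -
  obtain C where C: "\<And>x. \<bar>poly (pCons 0 (signed_hermite a)) x * exp (- x\<^sup>2 / 2)\<bar> \<le> C"
    using poly_gaussian_bounded by metis
  have "\<bar>gaussian_deriv a x\<bar> \<le> C / \<bar>x\<bar>" if "x \<noteq> 0" for x
    using C[of x] that by (simp add: gaussian_deriv_def abs_mult field_simps)
  then show thesis using that by blast
qed

lemma gaussian_deriv_measurable [measurable]: "gaussian_deriv a \<in> borel_measurable borel"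
  unfolding gaussian_deriv_def[abs_def]
  by (intro borel_measurable_continuous_onI continuous_intros) auto

lemma gaussian_deriv_integrable: "integrable lborel (gaussian_deriv a)"
  unfolding gaussian_deriv_def[abs_def] by (rule poly_gaussian_integrable)

lemma gaussian_deriv_0_at_0: "gaussian_deriv 0 0 = 1"
  by (simp add: gaussian_deriv_def)

text \<open>The fundamental theorem of calculus on \<open>[-m, m]\<close>, followed by dominated
  convergence with the majorant \<open>norm (F' x)\<close>.\<close>

lemma integral_derivative_eq_0:
  fixes F F' :: "real \<Rightarrow> 'a::euclidean_space"
  assumes deriv: "\<And>x. (F has_vector_derivative F' x) (at x)"
    and int: "integrable lborel F'"
    and lim: "(\<lambda>m. F (real m)) \<longlonglongrightarrow> 0" "(\<lambda>m. F (- real m)) \<longlonglongrightarrow> 0"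
  shows "(\<integral>x. F' x \<partial>lborel) = 0"
proof -
  have part: "(\<integral>x. indicator {- real m .. real m} x *\<^sub>R F' x \<partial>lborel) = F (real m) - F (- real m)" for m
  proof -
    have int': "set_integrable lborel {- real m .. real m} F'"
      unfolding set_integrable_def using int by (rule integrable_mult_indicator[rotated]) simp
    have "(F' has_integral F (real m) - F (- real m)) {- real m .. real m}"
      using deriv by (intro fundamental_theorem_of_calculus) (auto intro: has_vector_derivative_at_within)
    then show ?thesis
      using set_borel_integral_eq_integral(2)[OF int']
      by (simp add: set_lebesgue_integral_def integral_unique)
  qed
  have "(\<lambda>m. \<integral>x. indicator {- real m .. real m} x *\<^sub>R F' x \<partial>lborel) \<longlonglongrightarrow> (\<integral>x. F' x \<partial>lborel)"
  proof (rule integral_dominated_convergence[where w = "\<lambda>x. norm (F' x)"])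
    show "AE x in lborel. (\<lambda>m. indicator {- real m .. real m} x *\<^sub>R F' x) \<longlonglongrightarrow> F' x"
    proof (rule AE_I2)
      fix x :: real
      obtain m0 :: nat where m0: "\<bar>x\<bar> \<le> real m0" using real_arch_simple by blast
      have "\<forall>\<^sub>F m in sequentially. indicator {- real m .. real m} x *\<^sub>R F' x = F' x"
        using eventually_ge_at_top[of m0] by eventually_elim (use m0 in \<open>auto simp: indicator_def\<close>)
      then show "(\<lambda>m. indicator {- real m .. real m} x *\<^sub>R F' x) \<longlonglongrightarrow> F' x"
        by (rule tendsto_eventually)
    qed
  qed (use int in \<open>auto simp: indicator_def\<close>)
  moreover have "(\<lambda>m. F (real m) - F (- real m)) \<longlonglongrightarrow> 0 - 0"
    by (intro tendsto_diff lim)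
  ultimately show ?thesis
    using LIMSEQ_unique by (simp add: part) blast
qed

section \<open>Windowed Fourier integrals of bounded functions\<close>

definition bounded_borel :: "(real \<Rightarrow> real) \<Rightarrow> bool" where
  "bounded_borel f \<longleftrightarrow> f \<in> borel_measurable borel \<and> bounded (range f)"

lemma bounded_borel_add:
  "bounded_borel f \<Longrightarrow> bounded_borel g \<Longrightarrow> bounded_borel (\<lambda>\<tau>. f \<tau> + g \<tau>)"
  unfolding bounded_borel_def by (auto intro: bounded_plus_comp)

lemma bounded_borel_cmult: "bounded_borel f \<Longrightarrow> bounded_borel (\<lambda>\<tau>. c * f \<tau>)"
  using bounded_scaling[of "range f" c] unfolding bounded_borel_def by (auto simp: image_image)

lemma bounded_borel_const: "bounded_borel (\<lambda>_. c)"
  by (simp add: bounded_borel_def image_constant_conv)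

lemma bounded_borel_lincomb:
  assumes "\<And>i. i \<in> I \<Longrightarrow> bounded_borel (f i)"
  shows "bounded_borel (\<lambda>\<tau>. \<Sum>i\<in>I. c i * f i \<tau>)"
  using assms
proof (induction I rule: infinite_finite_induct)
  case (insert i I)
  then show ?case
    using bounded_borel_add[OF bounded_borel_cmult[of "f i"]] by simp
qed (simp_all add: bounded_borel_const)

lemma bounded_borel_reflect:
  assumes "bounded_borel f" shows "bounded_borel (\<lambda>\<tau>. f (- \<tau>))"
proof -
  have [measurable]: "f \<in> borel_measurable borel" and f: "bounded (range f)"
    using assms by (simp_all add: bounded_borel_def)
  have "bounded (range (\<lambda>\<tau>. f (- \<tau>)))"
    by (rule bounded_subset[OF f]) auto
  moreover have "(\<lambda>\<tau>. f (- \<tau>)) \<in> borel_measurable borel"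
    by measurable
  ultimately show ?thesis by (simp add: bounded_borel_def)
qed

text \<open>The window is \<open>\<tau> \<mapsto> exp (- (\<epsilon> * \<tau>)\<^sup>2 / 2)\<close>,
  and its derivative of order \<open>a\<close> enters with the sign \<open>(-1)^a\<close> of
  \<open>a\<close> integrations by parts. Formally the window is thus paired with the derivative of
  order \<open>a\<close> of \<open>exp (- \<i> \<omega> \<tau>) f \<tau>\<close>. The window
  supplies the integrability, so \<open>f\<close> itself may be merely bounded and
  measurable.\<close>

definition damped_fourier :: "real \<Rightarrow> real \<Rightarrow> (real \<Rightarrow> real) \<Rightarrow> nat \<Rightarrow> complex" where
  "damped_fourier \<epsilon> \<omega> f a = of_real ((- \<epsilon>) ^ a) *
     (\<integral>\<tau>. of_real (gaussian_deriv a (\<epsilon> * \<tau>)) * (exp (- \<i> * of_real (\<omega> * \<tau>)) * of_real (f \<tau>)) \<partial>lborel)"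

lemma damped_fourier_integrable:
  assumes f: "bounded_borel f" and \<epsilon>: "\<epsilon> \<noteq> 0"
  shows "integrable lborel (\<lambda>\<tau>. complex_of_real (gaussian_deriv a (\<epsilon> * \<tau>)) *
    (exp (- \<i> * of_real (\<omega> * \<tau>)) * of_real (f \<tau>)))"
proof -
  obtain B where B: "\<And>\<tau>. \<bar>f \<tau>\<bar> \<le> B" using f unfolding bounded_borel_def bounded_iff by auto
  have [measurable]: "f \<in> borel_measurable borel" using f by (simp add: bounded_borel_def)
  have "integrable lborel (\<lambda>\<tau>. B * gaussian_deriv a (\<epsilon> * \<tau>))"
    using lborel_integrable_real_affine[OF gaussian_deriv_integrable[of a] \<epsilon>, of 0]
    by (intro integrable_mult_right) simp
  then show ?thesis
  proof (rule Bochner_Integration.integrable_bound)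
    show "AE \<tau> in lborel. norm (complex_of_real (gaussian_deriv a (\<epsilon> * \<tau>)) *
        (exp (- \<i> * of_real (\<omega> * \<tau>)) * of_real (f \<tau>))) \<le> norm (B * gaussian_deriv a (\<epsilon> * \<tau>))"
    proof (rule AE_I2)
      fix \<tau>
      have "\<bar>f \<tau>\<bar> \<le> \<bar>B\<bar>" using B[of \<tau>] by linarith
      then show "norm (complex_of_real (gaussian_deriv a (\<epsilon> * \<tau>)) *
        (exp (- \<i> * of_real (\<omega> * \<tau>)) * of_real (f \<tau>))) \<le> norm (B * gaussian_deriv a (\<epsilon> * \<tau>))"
        by (simp add: norm_mult abs_mult mult.commute mult_right_mono)
    qed
  qed measurable
qed

lemma damped_fourier_lincomb:
  assumes "\<And>i. i \<in> I \<Longrightarrow> bounded_borel (f i)" and \<epsilon>: "\<epsilon> \<noteq> 0"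
  shows "damped_fourier \<epsilon> \<omega> (\<lambda>\<tau>. \<Sum>i\<in>I. c i * f i \<tau>) a = (\<Sum>i\<in>I. of_real (c i) * damped_fourier \<epsilon> \<omega> (f i) a)"
proof -
  let ?k = "\<lambda>i \<tau>. complex_of_real (gaussian_deriv a (\<epsilon> * \<tau>)) * (exp (- \<i> * of_real (\<omega> * \<tau>)) * of_real (f i \<tau>))"
  have "(\<integral>\<tau>. of_real (gaussian_deriv a (\<epsilon> * \<tau>)) * (exp (- \<i> * of_real (\<omega> * \<tau>)) *
      of_real (\<Sum>i\<in>I. c i * f i \<tau>)) \<partial>lborel) = (\<integral>\<tau>. (\<Sum>i\<in>I. of_real (c i) * ?k i \<tau>) \<partial>lborel)"
    by (simp add: sum_distrib_left ac_simps)
  also have "\<dots> = (\<Sum>i\<in>I. of_real (c i) * (\<integral>\<tau>. ?k i \<tau> \<partial>lborel))"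
    by (subst Bochner_Integration.integral_sum,
        intro integrable_mult_right damped_fourier_integrable assms, assumption)
      (simp only: integral_mult_right_zero)
  finally show ?thesis
    unfolding damped_fourier_def by (simp add: sum_distrib_left ac_simps)
qed

lemma damped_fourier_add:
  assumes "bounded_borel f" "bounded_borel g" and \<epsilon>: "\<epsilon> \<noteq> 0"
  shows "damped_fourier \<epsilon> \<omega> (\<lambda>\<tau>. f \<tau> + g \<tau>) a = damped_fourier \<epsilon> \<omega> f a + damped_fourier \<epsilon> \<omega> g a"
  using damped_fourier_lincomb[of UNIV "\<lambda>b. if b then f else g" \<epsilon> \<omega> "\<lambda>_. 1" a] assms
  by (simp add: UNIV_bool add.commute split: if_splits)

lemma damped_fourier_cmult:
  assumes "bounded_borel f" and \<epsilon>: "\<epsilon> \<noteq> 0"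
  shows "damped_fourier \<epsilon> \<omega> (\<lambda>\<tau>. c * f \<tau>) a = of_real c * damped_fourier \<epsilon> \<omega> f a"
  using damped_fourier_lincomb[of "{()}" "\<lambda>_. f" \<epsilon> \<omega> "\<lambda>_. c" a] assms by simp

lemma damped_fourier_zero [simp]: "damped_fourier \<epsilon> \<omega> (\<lambda>_. 0) a = 0"
  by (simp add: damped_fourier_def)

text \<open>Integration by parts. In the order \<open>a\<close>, the shift acts as differentiation
  of \<open>f\<close> minus multiplication by \<open>\<i> \<omega>\<close>. The frequency is thereby
  built into the recurrence, and for this reason all polynomials are later evaluated at 0 instead of
  \<open>\<i> \<omega>\<close>.\<close>

lemma damped_fourier_DERIV:
  assumes f: "bounded_borel f" and f': "bounded_borel f'"
    and deriv: "\<And>\<tau>. (f has_real_derivative f' \<tau>) (at \<tau>)" and \<epsilon>: "\<epsilon> \<noteq> 0"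
  shows "damped_fourier \<epsilon> \<omega> f (Suc a)
    = damped_fourier \<epsilon> \<omega> f' a - \<i> * of_real \<omega> * damped_fourier \<epsilon> \<omega> f a"
proof -
  define k where "k b h \<tau> = complex_of_real (gaussian_deriv b (\<epsilon> * \<tau>)) *
    (exp (- \<i> * of_real (\<omega> * \<tau>)) * complex_of_real (h \<tau>))" for b h \<tau>
  have k_int: "integrable lborel (k b h)" if "bounded_borel h" for b h
    unfolding k_def[abs_def] using that \<epsilon> by (rule damped_fourier_integrable)
  \<comment> \<open>The product rule applied to window, exponential and \<open>f\<close>; the inner
    derivative of the window contributes the factor \<open>\<epsilon>\<close>.\<close>
  define F' where "F' \<tau> = of_real \<epsilon> * k (Suc a) f \<tau> + (k a f' \<tau> - \<i> * of_real \<omega> * k a f \<tau>)" for \<tau>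
  have dF: "(k a f has_vector_derivative F' \<tau>) (at \<tau>)" for \<tau>
  proof -
    have 1: "((\<lambda>\<tau>. gaussian_deriv a (\<epsilon> * \<tau>)) has_real_derivative gaussian_deriv (Suc a) (\<epsilon> * \<tau>) * \<epsilon>) (at \<tau>)"
      by (rule DERIV_chain'[OF _ gaussian_deriv_DERIV]) (auto intro!: derivative_eq_intros)
    have 2: "((\<lambda>\<tau>. exp (- \<i> * of_real (\<omega> * \<tau>))) has_vector_derivative
        - \<i> * of_real \<omega> * exp (- \<i> * of_real (\<omega> * \<tau>))) (at \<tau>)"
    proof -
      have "((\<lambda>z. exp (- \<i> * (of_real \<omega> * z))) has_field_derivative
        - \<i> * of_real \<omega> * exp (- \<i> * (of_real \<omega> * of_real \<tau>))) (at (of_real \<tau>))"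
        by (auto intro!: derivative_eq_intros)
      from has_vector_derivative_real_field[OF this] show ?thesis by simp
    qed
    have of_real: "((\<lambda>\<tau>. complex_of_real (h \<tau>)) has_vector_derivative of_real d) (at \<tau>)"
      if "(h has_real_derivative d) (at \<tau>)" for h d
      using that by (intro has_vector_derivative_of_real) (simp add: has_real_derivative_iff_has_vector_derivative)
    show ?thesis
      unfolding k_def[abs_def]
      by (rule has_vector_derivative_eq_rhs)
        (rule has_vector_derivative_mult[OF of_real[OF 1] has_vector_derivative_mult[OF 2 of_real[OF deriv]]],
          simp add: F'_def k_def algebra_simps)
  qed
  obtain B where B: "\<And>\<tau>. \<bar>f \<tau>\<bar> \<le> B" using f unfolding bounded_borel_def bounded_iff by auto
  obtain C where C: "\<And>x. x \<noteq> 0 \<Longrightarrow> \<bar>gaussian_deriv a x\<bar> \<le> C / \<bar>x\<bar>"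
    using gaussian_deriv_decay by metis
  \<comment> \<open>Since \<open>f\<close> is only bounded, the decay at infinity comes from the
    window alone.\<close>
  have bound: "norm (k a f \<tau>) \<le> C / \<bar>\<epsilon>\<bar> * B * inverse \<bar>\<tau>\<bar>" if "\<tau> \<noteq> 0" for \<tau>
  proof -
    have "norm (k a f \<tau>) = \<bar>gaussian_deriv a (\<epsilon> * \<tau>)\<bar> * \<bar>f \<tau>\<bar>"
      by (simp add: k_def norm_mult)
    also have "\<dots> \<le> C / \<bar>\<epsilon> * \<tau>\<bar> * B"
      using C[of "\<epsilon> * \<tau>"] B[of \<tau>] that \<epsilon>
      by (intro mult_mono order_trans[OF abs_ge_zero C]) auto
    finally show ?thesis by (simp add: abs_mult divide_inverse ac_simps)
  qed
  have lim: "(\<lambda>m. C / \<bar>\<epsilon>\<bar> * B * inverse (real m)) \<longlonglongrightarrow> 0"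
    using tendsto_mult_right_zero[OF lim_inverse_n] .
  have ev: "\<forall>\<^sub>F m in sequentially. m \<noteq> (0::nat)" using eventually_gt_at_top[of 0] by eventually_elim simp
  have "(\<integral>\<tau>. F' \<tau> \<partial>lborel) = 0"
  proof (rule integral_derivative_eq_0[OF dF])
    show "integrable lborel F'"
      unfolding F'_def[abs_def] using k_int f f' by auto
    show "(\<lambda>m. k a f (real m)) \<longlonglongrightarrow> 0"
    proof (rule Lim_null_comparison[OF _ lim])
      show "\<forall>\<^sub>F m in sequentially. norm (k a f (real m)) \<le> C / \<bar>\<epsilon>\<bar> * B * inverse (real m)"
        using ev
      proof eventually_elim
        case (elim m)
        then show ?case using bound[of "real m"] by simp
      qed
    qed
    show "(\<lambda>m. k a f (- real m)) \<longlonglongrightarrow> 0"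
    proof (rule Lim_null_comparison[OF _ lim])
      show "\<forall>\<^sub>F m in sequentially. norm (k a f (- real m)) \<le> C / \<bar>\<epsilon>\<bar> * B * inverse (real m)"
        using ev
      proof eventually_elim
        case (elim m)
        then show ?case using bound[of "- real m"] by simp
      qed
    qed
  qed
  moreover have "(\<integral>\<tau>. F' \<tau> \<partial>lborel) = of_real \<epsilon> * (\<integral>\<tau>. k (Suc a) f \<tau> \<partial>lborel)
      + ((\<integral>\<tau>. k a f' \<tau> \<partial>lborel) - \<i> * of_real \<omega> * (\<integral>\<tau>. k a f \<tau> \<partial>lborel))"
    unfolding F'_def using k_int f f' by simp
  ultimately have "- of_real \<epsilon> * (\<integral>\<tau>. k (Suc a) f \<tau> \<partial>lborel)
      = (\<integral>\<tau>. k a f' \<tau> \<partial>lborel) - \<i> * of_real \<omega> * (\<integral>\<tau>. k a f \<tau> \<partial>lborel)"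
    by (simp add: algebra_simps eq_neg_iff_add_eq_0)
  \<comment> \<open>The remaining factor \<open>- \<epsilon>\<close> on the left raises the
    normalisation from order \<open>a\<close> to order \<open>Suc a\<close>.\<close>
  from arg_cong[where f = "\<lambda>z. of_real ((- \<epsilon>) ^ a) * z", OF this]
  show ?thesis
    unfolding damped_fourier_def k_def by (simp add: algebra_simps)
qed

text \<open>Substituting \<open>- \<tau>\<close> conjugates the exponential, while the window
  derivative has the parity of \<open>a\<close>.\<close>

lemma damped_fourier_reflect:
  "damped_fourier \<epsilon> \<omega> (\<lambda>\<tau>. f (- \<tau>)) a = (-1) ^ a * cnj (damped_fourier \<epsilon> \<omega> f a)"
proof -
  let ?k = "\<lambda>\<tau>. complex_of_real (gaussian_deriv a (\<epsilon> * \<tau>)) * (exp (- \<i> * of_real (\<omega> * \<tau>)) * of_real (f \<tau>))"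
  have "(\<integral>\<tau>. complex_of_real (gaussian_deriv a (\<epsilon> * \<tau>)) * (exp (- \<i> * of_real (\<omega> * \<tau>)) * of_real (f (- \<tau>))) \<partial>lborel)
     = (\<integral>\<tau>. complex_of_real (gaussian_deriv a (\<epsilon> * (- \<tau>))) * (exp (- \<i> * of_real (\<omega> * (- \<tau>))) * of_real (f \<tau>)) \<partial>lborel)"
    by (subst lborel_integral_real_affine[of "-1" _ 0]) simp_all
  also have "\<dots> = (\<integral>\<tau>. (-1) ^ a * cnj (?k \<tau>) \<partial>lborel)"
    by (rule Bochner_Integration.integral_cong) (simp_all add: gaussian_deriv_minus exp_cnj)
  also have "\<dots> = (-1) ^ a * cnj (\<integral>\<tau>. ?k \<tau> \<partial>lborel)"
    using Bochner_Integration.integral_cnj[of lborel ?k] by (simp only: integral_mult_right_zero)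
  finally show ?thesis by (simp add: damped_fourier_def)
qed

text \<open>Dominated convergence as the window widens: at order 0 the window tends to 1, and at
  higher orders the prefactor \<open>(- \<epsilon>) ^ a\<close> tends to 0 while the integrals
  converge.\<close>

lemma damped_fourier_tendsto:
  assumes f: "integrable lborel f"
  shows "(\<lambda>m. damped_fourier (1 / Suc m) \<omega> f a)
    \<longlonglongrightarrow> (if a = 0 then \<integral>\<tau>. exp (- \<i> * of_real (\<omega> * \<tau>)) * of_real (f \<tau>) \<partial>lborel else 0)"
proof -
  let ?e = "\<lambda>m. 1 / real (Suc m)"
  have e: "?e \<longlonglongrightarrow> 0" using LIMSEQ_inverse_real_of_nat by (simp add: inverse_eq_divide)
  have [measurable]: "f \<in> borel_measurable borel" using f by auto
  obtain C where C: "\<And>x. \<bar>gaussian_deriv a x\<bar> \<le> C" using gaussian_deriv_bounded by metis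
  have "(\<lambda>m. \<integral>\<tau>. of_real (gaussian_deriv a (?e m * \<tau>)) * (exp (- \<i> * of_real (\<omega> * \<tau>)) * of_real (f \<tau>)) \<partial>lborel)
      \<longlonglongrightarrow> (\<integral>\<tau>. of_real (gaussian_deriv a 0) * (exp (- \<i> * of_real (\<omega> * \<tau>)) * of_real (f \<tau>)) \<partial>lborel)"
  proof (rule integral_dominated_convergence[where w = "\<lambda>\<tau>. C * \<bar>f \<tau>\<bar>"])
    show "AE \<tau> in lborel. (\<lambda>m. complex_of_real (gaussian_deriv a (?e m * \<tau>)) * (exp (- \<i> * of_real (\<omega> * \<tau>)) * of_real (f \<tau>)))
      \<longlonglongrightarrow> of_real (gaussian_deriv a 0) * (exp (- \<i> * of_real (\<omega> * \<tau>)) * of_real (f \<tau>))"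
    proof (rule AE_I2, intro tendsto_mult_right tendsto_of_real)
      fix \<tau>
      have "isCont (gaussian_deriv a) 0" by (rule DERIV_isCont[OF gaussian_deriv_DERIV])
      from isCont_tendsto_compose[OF this tendsto_mult_left_zero[OF e]]
      show "(\<lambda>m. gaussian_deriv a (?e m * \<tau>)) \<longlonglongrightarrow> gaussian_deriv a 0" .
    qed
    show "AE \<tau> in lborel. norm (complex_of_real (gaussian_deriv a (?e m * \<tau>)) *
        (exp (- \<i> * of_real (\<omega> * \<tau>)) * of_real (f \<tau>))) \<le> C * \<bar>f \<tau>\<bar>" for m
      by (rule AE_I2) (simp add: norm_mult C mult_right_mono)
  qed (use f in auto)
  \<comment> \<open>The limit \<open>(- 0) ^ a\<close> is 1 for \<open>a = 0\<close> and 0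
    otherwise, which yields both cases of the claim at once.\<close>
  moreover have "(\<lambda>m. complex_of_real ((- ?e m) ^ a)) \<longlonglongrightarrow> of_real ((- 0) ^ a)"
    by (intro tendsto_of_real tendsto_power tendsto_minus e)
  ultimately have "(\<lambda>m. damped_fourier (?e m) \<omega> f a) \<longlonglongrightarrow> of_real ((- 0) ^ a) *
      (\<integral>\<tau>. of_real (gaussian_deriv a 0) * (exp (- \<i> * of_real (\<omega> * \<tau>)) * of_real (f \<tau>)) \<partial>lborel)"
    unfolding damped_fourier_def by (intro tendsto_mult)
  moreover have "of_real ((- 0) ^ a) * (\<integral>\<tau>. of_real (gaussian_deriv a 0) *
        (exp (- \<i> * of_real (\<omega> * \<tau>)) * of_real (f \<tau>)) \<partial>lborel)
      = (if a = 0 then \<integral>\<tau>. exp (- \<i> * of_real (\<omega> * \<tau>)) * of_real (f \<tau>) \<partial>lborel else 0)"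
    by (simp add: gaussian_deriv_0_at_0)
  ultimately show ?thesis by (simp only:)
qed

text \<open>In the limit only order 0 survives, and with it only the constant coefficient of
  \<open>r\<close>.\<close>

lemma shift_poly_damped_fourier_tendsto:
  assumes "integrable lborel f"
  shows "(\<lambda>m. shift_poly r (damped_fourier (1 / Suc m) \<omega> f) 0)
    \<longlonglongrightarrow> poly r 0 * (\<integral>\<tau>. exp (- \<i> * of_real (\<omega> * \<tau>)) * of_real (f \<tau>) \<partial>lborel)"
proof -
  let ?I = "\<integral>\<tau>. exp (- \<i> * of_real (\<omega> * \<tau>)) * of_real (f \<tau>) \<partial>lborel"
  have "(\<lambda>m. shift_poly r (damped_fourier (1 / Suc m) \<omega> f) 0)
      \<longlonglongrightarrow> (\<Sum>a\<le>degree r. coeff r a * (if a = 0 then ?I else 0))"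
    unfolding shift_poly_def add_0_right
    by (intro tendsto_sum tendsto_mult tendsto_const damped_fourier_tendsto assms)
  then show ?thesis by (simp add: if_distrib[of "(*) _"] poly_0_coeff_0 cong: if_cong)
qed

section \<open>Correlations of second-order processes\<close>

lemma integrable_mult_of_squares:
  fixes f g :: "'a \<Rightarrow> real"
  assumes [measurable]: "f \<in> borel_measurable M" "g \<in> borel_measurable M"
    and f2: "integrable M (\<lambda>x. (f x)\<^sup>2)" and g2: "integrable M (\<lambda>x. (g x)\<^sup>2)"
  shows "integrable M (\<lambda>x. f x * g x)"
proof (rule Bochner_Integration.integrable_bound[of M "\<lambda>x. (f x)\<^sup>2 + (g x)\<^sup>2"])
  show "AE x in M. norm (f x * g x) \<le> norm ((f x)\<^sup>2 + (g x)\<^sup>2)"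
  proof (rule AE_I2)
    fix x
    have "0 \<le> (\<bar>f x\<bar> - \<bar>g x\<bar>)\<^sup>2" by simp
    then have "2 * (\<bar>f x\<bar> * \<bar>g x\<bar>) \<le> (f x)\<^sup>2 + (g x)\<^sup>2" by (simp add: power2_diff)
    moreover have "0 \<le> \<bar>f x\<bar> * \<bar>g x\<bar>" by simp
    ultimately have "\<bar>f x\<bar> * \<bar>g x\<bar> \<le> (f x)\<^sup>2 + (g x)\<^sup>2" by linarith
    then show "norm (f x * g x) \<le> norm ((f x)\<^sup>2 + (g x)\<^sup>2)" by (simp add: abs_mult)
  qed
qed (use f2 g2 in auto)

lemma Cauchy_Schwarz_integral:
  fixes f g :: "'a \<Rightarrow> real"
  assumes f: "f \<in> borel_measurable M" and g: "g \<in> borel_measurable M"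
    and f2: "integrable M (\<lambda>x. (f x)\<^sup>2)" and g2: "integrable M (\<lambda>x. (g x)\<^sup>2)"
  shows "(\<integral>x. f x * g x \<partial>M)\<^sup>2 \<le> (\<integral>x. (f x)\<^sup>2 \<partial>M) * (\<integral>x. (g x)\<^sup>2 \<partial>M)"
proof -
  define a b c where "a = (\<integral>x. (f x)\<^sup>2 \<partial>M)" and "b = (\<integral>x. (g x)\<^sup>2 \<partial>M)"
    and "c = (\<integral>x. f x * g x \<partial>M)"
  note fg = integrable_mult_of_squares[OF f g f2 g2]
  have quad: "0 \<le> a - 2 * s * c + s\<^sup>2 * b" for s
  proof -
    have "0 \<le> (\<integral>x. (f x - s * g x)\<^sup>2 \<partial>M)" by simp
    also have "\<dots> = (\<integral>x. (f x)\<^sup>2 - (2 * s) * (f x * g x) + s\<^sup>2 * (g x)\<^sup>2 \<partial>M)"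
      by (simp add: power2_diff power_mult_distrib algebra_simps)
    also have "\<dots> = a - 2 * s * c + s\<^sup>2 * b"
      using f2 g2 fg by (simp add: a_def b_def c_def)
    finally show ?thesis .
  qed
  show ?thesis
  proof (cases "b = 0")
    case True
    then have "c = 0"
      \<comment> \<open>For \<open>b = 0\<close> the expression is affine in \<open>s\<close>; at
        this point it would equal \<open>-1\<close> if \<open>c\<close> were nonzero.\<close>
      using quad[of "(a + 1) / (2 * c)"] by (cases "c = 0") auto
    then show ?thesis using True by (simp add: b_def c_def)
  next
    case False
    then have "0 < b" unfolding b_def by (simp add: order_less_le)
    \<comment> \<open>The minimiser of the quadratic in \<open>s\<close>.\<close>
    with quad[of "c / b"] show ?thesis
      unfolding a_def[symmetric] b_def[symmetric] c_def[symmetric]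
      by (simp add: field_simps power2_eq_square)
  qed
qed

lemma second_order_mult_integrable:
  "second_order P X \<Longrightarrow> second_order P Y \<Longrightarrow> integrable P (\<lambda>\<omega>. X t \<omega> * Y s \<omega>)"
  unfolding second_order_def by (intro integrable_mult_of_squares) auto

lemma second_order_lincomb:
  assumes "\<And>i. i \<in> I \<Longrightarrow> second_order P (X i)"
  shows "second_order P (\<lambda>t \<omega>. \<Sum>i\<in>I. c i * X i t \<omega>)"
proof -
  have "integrable P (\<lambda>\<omega>. \<Sum>i\<in>I. \<Sum>k\<in>I. c i * c k * (X i t \<omega> * X k t \<omega>))" for t
    by (intro Bochner_Integration.integrable_sum integrable_mult_right second_order_mult_integrable assms)
  then have "integrable P (\<lambda>\<omega>. (\<Sum>i\<in>I. c i * X i t \<omega>)\<^sup>2)" for t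
    by (simp add: power2_eq_square sum_product ac_simps)
  moreover have "(\<lambda>\<omega>. \<Sum>i\<in>I. c i * X i t \<omega>) \<in> borel_measurable P" for t
    using assms unfolding second_order_def
    by (intro borel_measurable_sum borel_measurable_times borel_measurable_const) simp
  ultimately show ?thesis unfolding second_order_def by blast
qed

lemma second_order_cong:
  assumes "\<And>t \<omega>. \<omega> \<in> space P \<Longrightarrow> X t \<omega> = X' t \<omega>"
  shows "second_order P X \<longleftrightarrow> second_order P X'"
proof -
  have "X t \<in> borel_measurable P \<longleftrightarrow> X' t \<in> borel_measurable P" for t
    using assms by (intro measurable_cong)
  moreover have "integrable P (\<lambda>\<omega>. (X t \<omega>)\<^sup>2) \<longleftrightarrow> integrable P (\<lambda>\<omega>. (X' t \<omega>)\<^sup>2)" for t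
    using assms by (intro Bochner_Integration.integrable_cong) auto
  ultimately show ?thesis unfolding second_order_def by simp
qed

lemma is_cross_correlation_cong:
  assumes "\<And>t \<omega>. \<omega> \<in> space P \<Longrightarrow> X t \<omega> = X' t \<omega>"
    and "\<And>t \<omega>. \<omega> \<in> space P \<Longrightarrow> Y t \<omega> = Y' t \<omega>"
  shows "is_cross_correlation P X Y R \<longleftrightarrow> is_cross_correlation P X' Y' R"
proof -
  have "(\<integral>\<omega>. X t \<omega> * Y s \<omega> \<partial>P) = (\<integral>\<omega>. X' t \<omega> * Y' s \<omega> \<partial>P)" for t s
    using assms by (intro Bochner_Integration.integral_cong) auto
  then show ?thesis unfolding is_cross_correlation_def by simp
qed

text \<open>Fixing the reference time 0 gives a canonical function of the lag, with which every
  \<open>R\<close> in \<open>is_cross_correlation\<close> coincides.\<close>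

definition correlation ::
  "'a measure \<Rightarrow> (real \<Rightarrow> 'a \<Rightarrow> real) \<Rightarrow> (real \<Rightarrow> 'a \<Rightarrow> real) \<Rightarrow> real \<Rightarrow> real" where
  "correlation P X Y \<tau> = (\<integral>\<omega>. X 0 \<omega> * Y (- \<tau>) \<omega> \<partial>P)"

lemma is_cross_correlation_eq:
  assumes "is_cross_correlation P X Y R" shows "R = correlation P X Y"
proof
  fix \<tau>
  show "R \<tau> = correlation P X Y \<tau>"
    using assms[unfolded is_cross_correlation_def, rule_format, of 0 \<tau>] by (simp add: correlation_def)
qed

lemma correlation_cong:
  assumes "\<And>t \<omega>. \<omega> \<in> space P \<Longrightarrow> X t \<omega> = X' t \<omega>"
    and "\<And>t \<omega>. \<omega> \<in> space P \<Longrightarrow> Y t \<omega> = Y' t \<omega>"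
  shows "correlation P X Y = correlation P X' Y'"
proof
  fix \<tau>
  show "correlation P X Y \<tau> = correlation P X' Y' \<tau>"
    unfolding correlation_def by (rule Bochner_Integration.integral_cong) (simp_all add: assms)
qed

lemma correlation_reflect:
  assumes "is_cross_correlation P X Y R"
  shows "correlation P Y X \<tau> = correlation P X Y (- \<tau>)"
proof -
  have "correlation P Y X \<tau> = (\<integral>\<omega>. X (- \<tau>) \<omega> * Y (- \<tau> - (- \<tau>)) \<omega> \<partial>P)"
    by (simp add: correlation_def mult.commute)
  also have "\<dots> = R (- \<tau>)"
    using assms unfolding is_cross_correlation_def by blast
  finally show ?thesis using is_cross_correlation_eq[OF assms] by simp
qed

lemma is_cross_correlation_commute:
  assumes "is_cross_correlation P X Y R"
  shows "is_cross_correlation P Y X (\<lambda>\<tau>. R (- \<tau>))"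
  unfolding is_cross_correlation_def
proof safe
  fix t \<tau>
  show "(\<integral>\<omega>. Y t \<omega> * X (t - \<tau>) \<omega> \<partial>P) = R (- \<tau>)"
    using assms[unfolded is_cross_correlation_def, rule_format, of "t - \<tau>" "-\<tau>"]
    by (simp add: mult.commute)
qed

lemma integral_mult_lincomb:
  assumes "\<And>i. i \<in> I \<Longrightarrow> second_order P (X i)" "second_order P Z"
  shows "(\<integral>\<omega>. (\<Sum>i\<in>I. c i * X i t \<omega>) * Z s \<omega> \<partial>P) = (\<Sum>i\<in>I. c i * (\<integral>\<omega>. X i t \<omega> * Z s \<omega> \<partial>P))"
proof -
  have "(\<integral>\<omega>. (\<Sum>i\<in>I. c i * X i t \<omega>) * Z s \<omega> \<partial>P) = (\<integral>\<omega>. (\<Sum>i\<in>I. c i * (X i t \<omega> * Z s \<omega>)) \<partial>P)"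
    by (simp add: sum_distrib_right mult.assoc)
  also have "\<dots> = (\<Sum>i\<in>I. c i * (\<integral>\<omega>. X i t \<omega> * Z s \<omega> \<partial>P))"
    by (subst Bochner_Integration.integral_sum,
        intro integrable_mult_right second_order_mult_integrable assms, assumption)
      (simp only: integral_mult_right_zero)
  finally show ?thesis .
qed

lemma correlation_lincomb:
  assumes "\<And>i. i \<in> I \<Longrightarrow> second_order P (X i)" "second_order P Z"
  shows "correlation P (\<lambda>t \<omega>. \<Sum>i\<in>I. c i * X i t \<omega>) Z \<tau> = (\<Sum>i\<in>I. c i * correlation P (X i) Z \<tau>)"
  unfolding correlation_def by (intro integral_mult_lincomb assms)

lemma is_cross_correlation_lincomb:
  assumes "\<And>i. i \<in> I \<Longrightarrow> second_order P (X i)" "second_order P Z"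
    and "\<And>i. i \<in> I \<Longrightarrow> is_cross_correlation P (X i) Z (R i)"
  shows "is_cross_correlation P (\<lambda>t \<omega>. \<Sum>i\<in>I. c i * X i t \<omega>) Z (\<lambda>\<tau>. \<Sum>i\<in>I. c i * R i \<tau>)"
  using assms(3) unfolding is_cross_correlation_def
  by (subst integral_mult_lincomb[OF assms(1,2)]) simp_all

text \<open>Cauchy-Schwarz; stationarity makes the second moment of \<open>Y (- \<tau>)\<close>
  equal to \<open>R 0\<close> at every lag.\<close>

lemma bounded_correlation:
  assumes X: "second_order P X" and Y: "second_order P Y" and YY: "is_cross_correlation P Y Y R"
  shows "bounded (range (correlation P X Y))"
  unfolding bounded_iff
proof (intro exI ballI, safe)
  fix \<tau>
  have "(\<integral>\<omega>. (Y (- \<tau>) \<omega>)\<^sup>2 \<partial>P) = R 0"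
    using YY[unfolded is_cross_correlation_def, rule_format, of "-\<tau>" 0] by (simp add: power2_eq_square)
  then have "(correlation P X Y \<tau>)\<^sup>2 \<le> (\<integral>\<omega>. (X 0 \<omega>)\<^sup>2 \<partial>P) * R 0"
    using X Y Cauchy_Schwarz_integral[of "X 0" P "Y (- \<tau>)"]
    by (simp add: correlation_def second_order_def)
  then show "norm (correlation P X Y \<tau>) \<le> sqrt ((\<integral>\<omega>. (X 0 \<omega>)\<^sup>2 \<partial>P) * R 0)"
    by (simp add: real_le_rsqrt)
qed

text \<open>Stationarity moves the increment of the lag from \<open>Z\<close> to \<open>X\<close>:
  the correlation at \<open>\<tau> + h\<close> is the expectation of \<open>X h\<close> times
  \<open>Z (- \<tau>)\<close>. The error of the difference quotient is then the mean-square error of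
  \<open>X\<close> paired with the fixed variable \<open>Z (- \<tau>)\<close>, and Cauchy-Schwarz
  applies.\<close>

lemma correlation_DERIV:
  assumes deriv: "has_ms_derivative P X D" and Z: "second_order P Z"
    and XZ: "is_cross_correlation P X Z R"
  shows "(correlation P X Z has_real_derivative correlation P D Z \<tau>) (at \<tau>)"
proof -
  have X: "second_order P X" and D: "second_order P D"
    and lim: "((\<lambda>h. \<integral>\<omega>. ((X (0 + h) \<omega> - X 0 \<omega>) / h - D 0 \<omega>)\<^sup>2 \<partial>P) \<longlongrightarrow> 0) (at 0)"
    using deriv unfolding has_ms_derivative_def by blast+
  define E where "E h \<omega> = (X h \<omega> - X 0 \<omega>) / h - D 0 \<omega>" for h \<omega>
  define e where "e h = (correlation P X Z (\<tau> + h) - correlation P X Z \<tau>) / h - correlation P D Z \<tau>" for h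
  define K where "K = (\<integral>\<omega>. (Z (- \<tau>) \<omega>)\<^sup>2 \<partial>P)"
  have bound: "(e h)\<^sup>2 \<le> (\<integral>\<omega>. (E h \<omega>)\<^sup>2 \<partial>P) * K" for h
  proof -
    \<comment> \<open>The error \<open>E h\<close> as a combination of three processes frozen in
      time, so that the linearity lemmas apply. At \<open>h = 0\<close> the quotients are 0 by
      convention, consistently in \<open>E\<close>, \<open>e\<close> and \<open>a\<close>.\<close>
    define V where "V = (\<lambda>(k::nat) (t::real). if k = 0 then X h else if k = 1 then X 0 else D 0)"
    define a where "a = (\<lambda>k::nat. if k = 0 then 1 / h else if k = 1 then - (1 / h) else - 1)"
    have V: "second_order P (V k)" for k
      using X D by (simp add: V_def second_order_def)
    have E: "E h = (\<lambda>\<omega>. \<Sum>k<3. a k * V k 0 \<omega>)"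
      by (rule ext) (simp add: E_def a_def V_def eval_nat_numeral diff_divide_distrib)
    have "correlation P X Z (\<tau> + h) = (\<integral>\<omega>. X h \<omega> * Z (- \<tau>) \<omega> \<partial>P)"
      using XZ[unfolded is_cross_correlation_def, rule_format, of h "\<tau> + h"] is_cross_correlation_eq[OF XZ]
      by simp
    then have "e h = (\<Sum>k<3. a k * (\<integral>\<omega>. V k 0 \<omega> * Z (- \<tau>) \<omega> \<partial>P))"
      by (simp add: e_def a_def V_def correlation_def eval_nat_numeral diff_divide_distrib)
    also have "\<dots> = (\<integral>\<omega>. E h \<omega> * Z (- \<tau>) \<omega> \<partial>P)"
      unfolding E by (rule integral_mult_lincomb[symmetric]) (use V Z in auto)
    finally have "e h = (\<integral>\<omega>. E h \<omega> * Z (- \<tau>) \<omega> \<partial>P)" .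
    moreover have "E h \<in> borel_measurable P" "integrable P (\<lambda>\<omega>. (E h \<omega>)\<^sup>2)"
      unfolding E using second_order_lincomb[of "{..<3}" P V a] V
      by (auto simp only: second_order_def)
    ultimately show ?thesis
      using Z Cauchy_Schwarz_integral[of "E h" P "Z (- \<tau>)"] by (simp add: K_def second_order_def)
  qed
  have "((\<lambda>h. (\<integral>\<omega>. (E h \<omega>)\<^sup>2 \<partial>P) * K) \<longlongrightarrow> 0) (at 0)"
    using tendsto_mult_left_zero[OF lim] by (simp add: E_def)
  then have "((\<lambda>h. (e h)\<^sup>2) \<longlongrightarrow> 0) (at 0)"
    by (rule Lim_null_comparison[rotated]) (simp add: bound)
  then have "((\<lambda>h. \<bar>e h\<bar>) \<longlongrightarrow> 0) (at 0)"
    using tendsto_real_sqrt[of "\<lambda>h. (e h)\<^sup>2" 0 "at 0"] by simp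
  then have "(e \<longlongrightarrow> 0) (at 0)"
    by (rule tendsto_rabs_zero_cancel)
  then show ?thesis
    unfolding DERIV_def e_def by (simp add: LIM_zero_iff)
qed

lemma correlation_add:
  assumes "second_order P X" "second_order P Y" "second_order P Z"
  shows "correlation P (\<lambda>t \<xi>. X t \<xi> + Y t \<xi>) Z \<tau> = correlation P X Z \<tau> + correlation P Y Z \<tau>"
  unfolding correlation_def using second_order_mult_integrable[OF assms(1,3)]
    second_order_mult_integrable[OF assms(2,3)]
  by (simp add: distrib_right)

lemma stationary_responseD:
  assumes resp: "stationary_response P F B w x"
    and F: "dim_row F = d" and B: "dim_col B = m"
  shows "\<And>t \<xi>. \<xi> \<in> space P \<Longrightarrow> x t \<xi> \<in> carrier_vec d"
    and "\<And>t \<xi>. \<xi> \<in> space P \<Longrightarrow> w t \<xi> \<in> carrier_vec m"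
    and "\<And>a. a < d \<Longrightarrow> second_order P (coord x a)"
    and "\<And>i. i < m \<Longrightarrow> second_order P (coord w i)"
    and "\<And>a a'. a < d \<Longrightarrow> a' < d \<Longrightarrow> \<exists>R. is_cross_correlation P (coord x a) (coord x a') R"
    and "\<And>a i. a < d \<Longrightarrow> i < m \<Longrightarrow> \<exists>R. is_cross_correlation P (coord x a) (coord w i) R"
proof -
  \<comment> \<open>Joint stationarity speaks of the stacked vector: positions below
    \<open>d\<close> carry the state, and position \<open>d + i\<close> carries input
    \<open>i\<close>.\<close>
  define u where "u = (\<lambda>t \<xi>. x t \<xi> @\<^sub>v w t \<xi>)"
  show x: "x t \<xi> \<in> carrier_vec d" and w: "w t \<xi> \<in> carrier_vec m" if "\<xi> \<in> space P" for t \<xi>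
    using resp that F B unfolding stationary_response_def by blast+
  have ux: "coord u a t \<xi> = coord x a t \<xi>" if "a < d" "\<xi> \<in> space P" for a t \<xi>
    using x[OF that(2), of t] w[OF that(2), of t] that(1) by (auto simp: coord_def u_def)
  have uw: "coord u (d + i) t \<xi> = coord w i t \<xi>" if "i < m" "\<xi> \<in> space P" for i t \<xi>
    using x[OF that(2), of t] w[OF that(2), of t] that(1) by (auto simp: coord_def u_def)
  have wss: "jointly_wss P (d + m) u"
    using resp F B unfolding stationary_response_def u_def by blast
  have so: "second_order P (coord u k)" if "k < d + m" for k
    using wss that unfolding jointly_wss_def wide_sense_stationary_def by blast
  have cc: "\<exists>R. is_cross_correlation P (coord u k) (coord u l) R" if "k < d + m" "l < d + m" for k l
    using wss that unfolding jointly_wss_def by blast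
  show "second_order P (coord x a)" if "a < d" for a
    using so[of a] that second_order_cong[OF ux] by fastforce
  show "second_order P (coord w i)" if "i < m" for i
    using so[of "d + i"] that second_order_cong[OF uw] by fastforce
  show "\<exists>R. is_cross_correlation P (coord x a) (coord x a') R" if "a < d" "a' < d" for a a'
    using cc[of a a'] that is_cross_correlation_cong[OF ux ux] by fastforce
  show "\<exists>R. is_cross_correlation P (coord x a) (coord w i) R" if "a < d" "i < m" for a i
    using cc[of a "d + i"] that is_cross_correlation_cong[OF ux uw] by fastforce
qed

lemma stationary_response_correlation_DERIV:
  assumes resp: "stationary_response P F B w x"
    and F: "F \<in> carrier_mat d d" and B: "B \<in> carrier_mat d m"
    and Z: "second_order P Z" and a: "a < d"
    and XZ: "is_cross_correlation P (coord x a) Z R"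
  shows "(correlation P (coord x a) Z has_real_derivative
    (\<Sum>k<d. F $$ (a, k) * correlation P (coord x k) Z \<tau>) +
    (\<Sum>i<m. B $$ (a, i) * correlation P (coord w i) Z \<tau>)) (at \<tau>)"
proof -
  have dims: "dim_row F = d" "dim_col B = m" using F B by auto
  note resp' = stationary_responseD[OF resp dims]
  define D where "D = (\<lambda>t \<xi>. (\<Sum>k<d. F $$ (a, k) * coord x k t \<xi>) + (\<Sum>i<m. B $$ (a, i) * coord w i t \<xi>))"
  \<comment> \<open>The matrix-vector products unfold on \<open>space P\<close>, where the
    dimensions are known; this is enough for expectations.\<close>
  have D: "coord (\<lambda>t \<xi>. F *\<^sub>v x t \<xi> + B *\<^sub>v w t \<xi>) a t \<xi> = D t \<xi>" if "\<xi> \<in> space P" for t \<xi>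
    using resp'(1)[OF that, of t] resp'(2)[OF that, of t] F B a
    by (simp add: coord_def D_def scalar_prod_def lessThan_atLeast0)
  have "has_ms_derivative P (coord x a) (coord (\<lambda>t \<xi>. F *\<^sub>v x t \<xi> + B *\<^sub>v w t \<xi>) a)"
    using resp a dims unfolding stationary_response_def by blast
  from correlation_DERIV[OF this Z XZ, of \<tau>]
  have "(correlation P (coord x a) Z has_real_derivative correlation P D Z \<tau>) (at \<tau>)"
    using correlation_cong[OF D, where Y = Z and Y' = Z] by simp
  moreover have "correlation P D Z \<tau> = (\<Sum>k<d. F $$ (a, k) * correlation P (coord x k) Z \<tau>) +
      (\<Sum>i<m. B $$ (a, i) * correlation P (coord w i) Z \<tau>)"
  proof -
    have x: "second_order P (coord x k)" if "k \<in> {..<d}" for k using that resp'(3) by simp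
    have w: "second_order P (coord w i)" if "i \<in> {..<m}" for i using that resp'(4) by simp
    have "correlation P D Z \<tau> = correlation P (\<lambda>t \<xi>. \<Sum>k<d. F $$ (a, k) * coord x k t \<xi>) Z \<tau> +
        correlation P (\<lambda>t \<xi>. \<Sum>i<m. B $$ (a, i) * coord w i t \<xi>) Z \<tau>"
      unfolding D_def by (intro correlation_add second_order_lincomb x w Z)
    also have "\<dots> = (\<Sum>k<d. F $$ (a, k) * correlation P (coord x k) Z \<tau>) +
        (\<Sum>i<m. B $$ (a, i) * correlation P (coord w i) Z \<tau>)"
      by (intro arg_cong2[where f = "(+)"] correlation_lincomb x w Z)
    finally show ?thesis .
  qed
  ultimately show ?thesis by simp
qed

section \<open>Spectral balance of a network\<close>

lemma block_index_less:
  assumes "i < N" "r < n" shows "i * n + r < N * (n::nat)"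
proof -
  have "i * n + r < Suc i * n" using assms by simp
  also have "\<dots> \<le> N * n" using assms by (intro mult_le_mono1) simp
  finally show ?thesis .
qed

lemma sum_blocks: "(\<Sum>a<N * n. f a) = (\<Sum>i<N. \<Sum>r<n. f (i * n + r :: nat))"
  by (simp add: sum_mult_product add.commute)

lemma network_mat_carrier:
  assumes "A \<in> carrier_mat n n" "b \<in> carrier_vec n" "c \<in> carrier_vec n" "G \<in> carrier_mat N N"
  shows "network_mat A b c G \<in> carrier_mat (N * n) (N * n)"
  using assms by (auto simp: network_mat_def kronecker_def col_mat_def row_mat_def)

lemma network_mat_index:
  assumes "A \<in> carrier_mat n n" "b \<in> carrier_vec n" "c \<in> carrier_vec n" "G \<in> carrier_mat N N"
    and "i < N" "k < N" "r < n" "s < n"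
  shows "network_mat A b c G $$ (i * n + r, k * n + s)
    = (if i = k then A $$ (r, s) else 0) + G $$ (i, k) * (b $ r * c $ s)"
  using assms block_index_less[of i N r n] block_index_less[of k N s n]
  by (simp add: network_mat_def kronecker_def col_mat_def row_mat_def scalar_prod_def
      mat_of_cols_def mat_of_rows_def)

lemma network_input_carrier:
  "b \<in> carrier_vec n \<Longrightarrow> 1\<^sub>m N \<otimes>\<^sub>K col_mat b \<in> carrier_mat (N * n) N"
  by (auto simp: kronecker_def col_mat_def)

lemma network_input_index:
  assumes "b \<in> carrier_vec n" "i < N" "k < N" "r < n"
  shows "(1\<^sub>m N \<otimes>\<^sub>K col_mat b) $$ (i * n + r, k) = (if i = k then b $ r else 0)"
  using assms block_index_less[of i N r n]
  by (simp add: kronecker_def col_mat_def mat_of_cols_def)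

lemma network_output_coord:
  assumes "c \<in> carrier_vec n" "x t \<xi> \<in> carrier_vec (N * n)" "i < N"
  shows "coord (network_output N c x) i t \<xi> = (\<Sum>s<n. c $ s * coord x (i * n + s) t \<xi>)"
proof -
  have "coord (network_output N c x) i t \<xi>
      = (\<Sum>a<N * n. (1\<^sub>m N \<otimes>\<^sub>K row_mat c) $$ (i, a) * x t \<xi> $ a)"
    using assms by (simp add: coord_def network_output_def scalar_prod_def lessThan_atLeast0
        kronecker_def row_mat_def)
  also have "\<dots> = (\<Sum>k<N. \<Sum>s<n. if i = k then c $ s * x t \<xi> $ (k * n + s) else 0)"
    unfolding sum_blocks using assms block_index_less[of _ N _ n]
    by (intro sum.cong refl) (simp add: kronecker_def row_mat_def mat_of_rows_def)
  also have "\<dots> = (\<Sum>k<N. if i = k then \<Sum>s<n. c $ s * x t \<xi> $ (k * n + s) else 0)"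
    by (intro sum.cong) auto
  finally show ?thesis using assms by (simp add: coord_def)
qed

text \<open>
  The node matrix is shifted by the frequency and closed with the gain \<open>\<mu>\<close>.  Choosing for
  \<open>\<mu>\<close> an eigenvalue of the connectivity matrix will make it nonsingular, even when \<open>\<i>\<omega>\<close> is an
  eigenvalue of \<open>A\<close> itself.
\<close>

definition node_mat :: "real mat \<Rightarrow> real vec \<Rightarrow> real vec \<Rightarrow> complex \<Rightarrow> real \<Rightarrow> complex mat" where
  "node_mat A b c \<mu> \<omega> = mat (dim_row A) (dim_row A) (\<lambda>(r, s).
     of_real (A $$ (r, s)) + \<mu> * of_real (b $ r * c $ s) - (if r = s then \<i> * of_real \<omega> else 0))"

definition node_num :: "real mat \<Rightarrow> real vec \<Rightarrow> real vec \<Rightarrow> complex \<Rightarrow> real \<Rightarrow> complex poly" where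
  "node_num A b c \<mu> \<omega> =
     transfer_numerator (node_mat A b c \<mu> \<omega>) (map_vec of_real b) (map_vec of_real c)"

text \<open>The entries of \<open>Q = (p + \<mu> q) I - q G\<close>. The summand
  \<open>\<mu> q\<close> undoes the feedback closed in \<open>node_mat\<close>: with that feedback
  in place, the input of a node is \<open>w + G y - \<mu> y\<close>.\<close>

definition balance_poly ::
  "real mat \<Rightarrow> real vec \<Rightarrow> real vec \<Rightarrow> complex \<Rightarrow> real \<Rightarrow> real mat \<Rightarrow> nat \<Rightarrow> nat \<Rightarrow> complex poly" where
  "balance_poly A b c \<mu> \<omega> G i k =
     (if i = k then char_poly (node_mat A b c \<mu> \<omega>) + Polynomial.smult \<mu> (node_num A b c \<mu> \<omega>) else 0)
     - Polynomial.smult (of_real (G $$ (i, k))) (node_num A b c \<mu> \<omega>)"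

text \<open>Collects what the full and the grounded network have in common, so that the spectral
  balance is proved once and interpreted for both.\<close>

locale white_network =
  fixes P :: "'a measure" and N n :: nat
    and A G :: "real mat" and b c :: "real vec"
    and w x :: "real \<Rightarrow> 'a \<Rightarrow> real vec" and Rw :: "real \<Rightarrow> real" and S :: "real \<Rightarrow> complex mat"
  assumes A: "A \<in> carrier_mat n n" and b: "b \<in> carrier_vec n" and c: "c \<in> carrier_vec n"
    and G: "G \<in> carrier_mat N N"
    and w_correlation: "\<And>i k. i < N \<Longrightarrow> k < N \<Longrightarrow>
      is_cross_correlation P (coord w i) (coord w k) (\<lambda>\<tau>. if i = k then Rw \<tau> else 0)"
    and Rw_integrable: "integrable lborel Rw"
    and network: "network_response P A b c G w x"
    and S: "has_cpsd_matrix P N (network_output N c x) S"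
begin

abbreviation X :: "nat \<Rightarrow> nat \<Rightarrow> real \<Rightarrow> 'a \<Rightarrow> real" where
  "X i r \<equiv> coord x (i * n + r)"

text \<open>Agrees with the output coordinate on \<open>space P\<close>
  (\<open>network_output_coord\<close>); the explicit sum suits the linearity lemmas.\<close>

abbreviation Y :: "nat \<Rightarrow> real \<Rightarrow> 'a \<Rightarrow> real" where
  "Y i \<equiv> (\<lambda>t \<xi>. \<Sum>s<n. c $ s * X i s t \<xi>)"

lemma response: "stationary_response P (network_mat A b c G) (1\<^sub>m N \<otimes>\<^sub>K col_mat b) w x"
  using network G unfolding network_response_def by simp

lemmas responseD = stationary_responseD[OF response
    carrier_matD(1)[OF network_mat_carrier[OF A b c G]] carrier_matD(2)[OF network_input_carrier[OF b]]]

lemma second_order_X: "i < N \<Longrightarrow> r < n \<Longrightarrow> second_order P (X i r)"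
  by (simp add: responseD(3) block_index_less)

lemma second_order_W: "i < N \<Longrightarrow> second_order P (coord w i)"
  by (simp add: responseD(4))

lemma second_order_Y: "i < N \<Longrightarrow> second_order P (Y i)"
  by (intro second_order_lincomb second_order_X) auto

lemma cross_XX:
  "\<lbrakk>i < N; r < n; k < N; s < n\<rbrakk> \<Longrightarrow> \<exists>R. is_cross_correlation P (X i r) (X k s) R"
  by (simp add: responseD(5) block_index_less)

lemma cross_XW: "\<lbrakk>i < N; r < n; k < N\<rbrakk> \<Longrightarrow> \<exists>R. is_cross_correlation P (X i r) (coord w k) R"
  by (simp add: responseD(6) block_index_less)

lemma cross_XY:
  assumes "i < N" "r < n" "k < N"
  shows "\<exists>R. is_cross_correlation P (X i r) (Y k) R"
proof -
  have "\<forall>s\<in>{..<n}. \<exists>R. is_cross_correlation P (X k s) (X i r) R"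
    using cross_XX assms by blast
  then obtain R where "\<And>s. s < n \<Longrightarrow> is_cross_correlation P (X k s) (X i r) (R s)"
    by (metis lessThan_iff)
  then have "is_cross_correlation P (Y k) (X i r) (\<lambda>\<tau>. \<Sum>s<n. c $ s * R s \<tau>)"
    using assms by (intro is_cross_correlation_lincomb second_order_X) auto
  then show ?thesis using is_cross_correlation_commute by blast
qed

lemma cross_YW:
  assumes "i < N" "k < N"
  shows "\<exists>R. is_cross_correlation P (Y i) (coord w k) R"
proof -
  have "\<forall>s\<in>{..<n}. \<exists>R. is_cross_correlation P (X i s) (coord w k) R"
    using cross_XW assms by blast
  then obtain R where "\<And>s. s < n \<Longrightarrow> is_cross_correlation P (X i s) (coord w k) (R s)"
    by (metis lessThan_iff)
  then have "is_cross_correlation P (Y i) (coord w k) (\<lambda>\<tau>. \<Sum>s<n. c $ s * R s \<tau>)"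
    using assms by (intro is_cross_correlation_lincomb second_order_X second_order_W) auto
  then show ?thesis by blast
qed

lemma output_cpsd:
  assumes "i < N" "k < N"
  obtains R where "is_cross_correlation P (Y i) (Y k) R" "integrable lborel R"
    "\<And>\<omega>. S \<omega> $$ (i, k) = (\<integral>\<tau>. exp (- \<i> * of_real (\<omega> * \<tau>)) * of_real (R \<tau>) \<partial>lborel)"
proof -
  have Y: "coord (network_output N c x) l t \<xi> = Y l t \<xi>" if "l < N" "\<xi> \<in> space P" for l t \<xi>
    using network_output_coord[where x = x and t = t, OF c responseD(1)[OF that(2)] that(1)] .
  have "has_cpsd P (coord (network_output N c x) i) (coord (network_output N c x) k) (\<lambda>\<omega>. S \<omega> $$ (i, k))"
    using S assms unfolding has_cpsd_matrix_def by blast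
  then obtain R where R: "is_cross_correlation P (coord (network_output N c x) i) (coord (network_output N c x) k) R"
    "integrable lborel R"
    "\<forall>\<omega>. S \<omega> $$ (i, k) = (\<integral>\<tau>. exp (- \<i> * of_real (\<omega> * \<tau>)) * of_real (R \<tau>) \<partial>lborel)"
    unfolding has_cpsd_def by blast
  have "is_cross_correlation P (coord (network_output N c x) i) (coord (network_output N c x) k) R
      \<longleftrightarrow> is_cross_correlation P (Y i) (Y k) R"
    by (rule is_cross_correlation_cong) (simp_all add: Y assms)
  with R show thesis by (intro that[of R]) simp_all
qed

text \<open>In the rows of node \<open>i\<close>, \<open>A\<close> acts within the block, and the
  factor \<open>b c^T\<close> of the coupling lets the nodes influence each other through their
  outputs alone.\<close>

lemma correlation_X_DERIV:
  assumes Z: "second_order P Z" and XZ: "\<exists>R. is_cross_correlation P (X i r) Z R"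
    and i: "i < N" and r: "r < n"
  shows "(correlation P (X i r) Z has_real_derivative
    (\<Sum>s<n. A $$ (r, s) * correlation P (X i s) Z \<tau>) + b $ r * (correlation P (coord w i) Z \<tau> +
      (\<Sum>k<N. G $$ (i, k) * correlation P (Y k) Z \<tau>))) (at \<tau>)"
proof -
  let ?C = "\<lambda>k s. correlation P (X k s) Z \<tau>"
  have "(\<Sum>a<N * n. network_mat A b c G $$ (i * n + r, a) * correlation P (coord x a) Z \<tau>)
      = (\<Sum>k<N. \<Sum>s<n. (if i = k then A $$ (r, s) * ?C k s else 0) + G $$ (i, k) * (b $ r * c $ s) * ?C k s)"
    unfolding sum_blocks using i r A b c G
    by (intro sum.cong refl) (simp add: network_mat_index distrib_right)
  also have "\<dots> = (\<Sum>k<N. (if i = k then \<Sum>s<n. A $$ (r, s) * ?C k s else 0)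
      + b $ r * (G $$ (i, k) * (\<Sum>s<n. c $ s * ?C k s)))"
    by (intro sum.cong refl) (simp add: sum.distrib sum_distrib_left ac_simps)
  also have "\<dots> = (\<Sum>s<n. A $$ (r, s) * ?C i s) + b $ r * (\<Sum>k<N. G $$ (i, k) * (\<Sum>s<n. c $ s * ?C k s))"
    using i by (simp add: sum.distrib sum_distrib_left)
  also have "(\<Sum>k<N. G $$ (i, k) * (\<Sum>s<n. c $ s * ?C k s)) = (\<Sum>k<N. G $$ (i, k) * correlation P (Y k) Z \<tau>)"
    using Z by (intro sum.cong refl arg_cong2[where f = "(*)"] correlation_lincomb[symmetric]) (auto simp: second_order_X)
  finally have x_part: "(\<Sum>a<N * n. network_mat A b c G $$ (i * n + r, a) * correlation P (coord x a) Z \<tau>)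
      = (\<Sum>s<n. A $$ (r, s) * ?C i s) + b $ r * (\<Sum>k<N. G $$ (i, k) * correlation P (Y k) Z \<tau>)" .
  have "(\<Sum>k<N. (1\<^sub>m N \<otimes>\<^sub>K col_mat b) $$ (i * n + r, k) * correlation P (coord w k) Z \<tau>)
      = (\<Sum>k<N. if i = k then b $ r * correlation P (coord w k) Z \<tau> else 0)"
    using i r b by (intro sum.cong refl) (simp add: network_input_index)
  then have w_part: "(\<Sum>k<N. (1\<^sub>m N \<otimes>\<^sub>K col_mat b) $$ (i * n + r, k) * correlation P (coord w k) Z \<tau>)
      = b $ r * correlation P (coord w i) Z \<tau>"
    using i by simp
  from XZ obtain R where "is_cross_correlation P (X i r) Z R" ..
  from stationary_response_correlation_DERIV[OF response network_mat_carrier[OF A b c G]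
      network_input_carrier[OF b] Z block_index_less[OF i r] this, of \<tau>]
  show ?thesis unfolding x_part w_part by (simp add: algebra_simps)
qed

text \<open>Measurability in the lag comes from differentiability, and boundedness from
  Cauchy-Schwarz.\<close>

lemma correlation_X_bounded_borel:
  assumes Z: "second_order P Z" and ZZ: "is_cross_correlation P Z Z R"
    and XZ: "\<exists>R. is_cross_correlation P (X i r) Z R" and i: "i < N" and r: "r < n"
  shows "bounded_borel (correlation P (X i r) Z)"
proof -
  have "continuous_on UNIV (correlation P (X i r) Z)"
    using correlation_X_DERIV[OF Z XZ i r] DERIV_isCont continuous_at_imp_continuous_on by blast
  then show ?thesis
    using bounded_correlation[OF second_order_X[OF i r] Z ZZ]
    by (simp add: bounded_borel_def borel_measurable_continuous_onI)
qed

lemma correlation_Y_bounded_borel: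
  assumes Z: "second_order P Z" and ZZ: "is_cross_correlation P Z Z R"
    and XZ: "\<And>r. r < n \<Longrightarrow> \<exists>R. is_cross_correlation P (X i r) Z R" and i: "i < N"
  shows "bounded_borel (correlation P (Y i) Z)"
proof -
  have "correlation P (Y i) Z = (\<lambda>\<tau>. \<Sum>s<n. c $ s * correlation P (X i s) Z \<tau>)"
    using i Z by (intro ext correlation_lincomb) (auto simp: second_order_X)
  then show ?thesis
    using correlation_X_bounded_borel[OF Z ZZ XZ i] by (auto intro: bounded_borel_lincomb)
qed

text \<open>Row \<open>i\<close> of \<open>Q y = q w\<close>, correlated with \<open>Z\<close>. The
  damped correlations of the state of node \<open>i\<close> satisfy a first-order recurrence in the
  order \<open>a\<close>, from which \<open>shift_poly_char_poly\<close> eliminates the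
  state.\<close>

lemma output_balance:
  assumes Z: "second_order P Z" and ZZ: "is_cross_correlation P Z Z R"
    and XZ: "\<And>i r. i < N \<Longrightarrow> r < n \<Longrightarrow> \<exists>R. is_cross_correlation P (X i r) Z R"
    and WZ: "\<And>i. i < N \<Longrightarrow> bounded_borel (correlation P (coord w i) Z)"
    and \<epsilon>: "\<epsilon> \<noteq> 0" and i: "i < N"
  shows "(\<Sum>k<N. shift_poly (balance_poly A b c \<mu> \<omega> G i k) (damped_fourier \<epsilon> \<omega> (correlation P (Y k) Z)) a)
    = shift_poly (node_num A b c \<mu> \<omega>) (damped_fourier \<epsilon> \<omega> (correlation P (coord w i) Z)) a"
proof -
  define M p q where "M = node_mat A b c \<mu> \<omega>" and "p = char_poly M" and "q = node_num A b c \<mu> \<omega>"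
  define JX where "JX s = damped_fourier \<epsilon> \<omega> (correlation P (X i s) Z)" for s
  define JY where "JY k = damped_fourier \<epsilon> \<omega> (correlation P (Y k) Z)" for k
  define JW where "JW = damped_fourier \<epsilon> \<omega> (correlation P (coord w i) Z)"
  \<comment> \<open>The feedback \<open>\<mu> y\<close> is moved into the matrix \<open>M\<close>
    and therefore subtracted from the input.\<close>
  define g where "g a = JW a + (\<Sum>k<N. of_real (G $$ (i, k)) * JY k a) - \<mu> * JY i a" for a
  have M: "M \<in> carrier_mat n n" using A by (simp add: M_def node_mat_def)
  note bX = correlation_X_bounded_borel[OF Z ZZ XZ] and bY = correlation_Y_bounded_borel[OF Z ZZ XZ]
  have JY: "JY i = (\<lambda>a. \<Sum>s<n. of_real (c $ s) * JX s a)"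
  proof
    fix a
    have "correlation P (Y i) Z = (\<lambda>\<tau>. \<Sum>s<n. c $ s * correlation P (X i s) Z \<tau>)"
      using i Z by (intro ext correlation_lincomb) (auto simp: second_order_X)
    then show "JY i a = (\<Sum>s<n. of_real (c $ s) * JX s a)"
      unfolding JY_def JX_def using i bX \<epsilon> by (simp only:, intro damped_fourier_lincomb) auto
  qed
  have rec: "JX r (Suc a) = (\<Sum>s<n. M $$ (r, s) * JX s a) + map_vec complex_of_real b $ r * g a"
    if r: "r < n" for r a
  proof -
    define h where "h \<tau> = correlation P (coord w i) Z \<tau> + (\<Sum>k<N. G $$ (i, k) * correlation P (Y k) Z \<tau>)" for \<tau>
    define f' where "f' \<tau> = (\<Sum>s<n. A $$ (r, s) * correlation P (X i s) Z \<tau>) + b $ r * h \<tau>" for \<tau>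
    have bYs: "bounded_borel (\<lambda>\<tau>. \<Sum>k<N. G $$ (i, k) * correlation P (Y k) Z \<tau>)"
      using bY by (intro bounded_borel_lincomb) auto
    have bXs: "bounded_borel (\<lambda>\<tau>. \<Sum>s<n. A $$ (r, s) * correlation P (X i s) Z \<tau>)"
      using bX i by (intro bounded_borel_lincomb) auto
    have bh: "bounded_borel h"
      unfolding h_def[abs_def] by (intro bounded_borel_add WZ i bYs)
    have bf': "bounded_borel f'"
      unfolding f'_def[abs_def] by (intro bounded_borel_add bounded_borel_cmult bh bXs)
    have JYs: "damped_fourier \<epsilon> \<omega> (\<lambda>\<tau>. \<Sum>k<N. G $$ (i, k) * correlation P (Y k) Z \<tau>) a
        = (\<Sum>k<N. of_real (G $$ (i, k)) * JY k a)"
      unfolding JY_def using bY \<epsilon> by (intro damped_fourier_lincomb) auto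
    have JXs: "damped_fourier \<epsilon> \<omega> (\<lambda>\<tau>. \<Sum>s<n. A $$ (r, s) * correlation P (X i s) Z \<tau>) a
        = (\<Sum>s<n. of_real (A $$ (r, s)) * JX s a)"
      unfolding JX_def using bX i \<epsilon> by (intro damped_fourier_lincomb) auto
    have Jh: "damped_fourier \<epsilon> \<omega> h a = JW a + (\<Sum>k<N. of_real (G $$ (i, k)) * JY k a)"
      unfolding h_def[abs_def] JW_def by (simp add: damped_fourier_add[OF WZ[OF i] bYs \<epsilon>] JYs)
    have "damped_fourier \<epsilon> \<omega> f' a = (\<Sum>s<n. of_real (A $$ (r, s)) * JX s a) + of_real (b $ r) * damped_fourier \<epsilon> \<omega> h a"
      unfolding f'_def[abs_def]
      by (simp add: damped_fourier_add[OF bXs bounded_borel_cmult[OF bh] \<epsilon>]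
          JXs damped_fourier_cmult[OF bh \<epsilon>])
    moreover have "JX r (Suc a) = damped_fourier \<epsilon> \<omega> f' a - \<i> * of_real \<omega> * JX r a"
      unfolding JX_def
      by (rule damped_fourier_DERIV[OF bX[OF i r i r] bf' _ \<epsilon>])
        (use correlation_X_DERIV[OF Z XZ[OF i r] i r] in \<open>simp add: f'_def h_def\<close>)
    ultimately have "JX r (Suc a) = (\<Sum>s<n. of_real (A $$ (r, s)) * JX s a) - \<i> * of_real \<omega> * JX r a
        + of_real (b $ r) * (g a + \<mu> * JY i a)"
      by (simp add: Jh g_def)
    also have "\<dots> = (\<Sum>s<n. of_real (A $$ (r, s)) * JX s a) - (\<Sum>s<n. if r = s then \<i> * of_real \<omega> * JX s a else 0)
        + (\<Sum>s<n. \<mu> * of_real (b $ r * c $ s) * JX s a) + of_real (b $ r) * g a"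
      using r by (simp add: JY sum_distrib_left algebra_simps)
    also have "\<dots> = (\<Sum>s<n. M $$ (r, s) * JX s a) + of_real (b $ r) * g a"
      unfolding sum_subtractf[symmetric] sum.distrib[symmetric]
      using r A by (intro arg_cong2[where f = "(+)"] sum.cong refl) (simp add: M_def node_mat_def algebra_simps)
    finally show ?thesis using r b by simp
  qed
  have "shift_poly p (JY i) a = shift_poly q g a"
    using shift_poly_char_poly[where J = JX and g = g, OF M rec, of "map_vec of_real c" a] c
    by (simp add: p_def q_def node_num_def JY flip: M_def)
  also have "\<dots> = shift_poly q JW a + (\<Sum>k<N. of_real (G $$ (i, k)) * shift_poly q (JY k) a) - \<mu> * shift_poly q (JY i) a"
    unfolding g_def
    by (simp add: shift_poly_diff_seq shift_poly_add_seq shift_poly_lincomb shift_poly_scale_seq)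
  finally have "shift_poly p (JY i) a + \<mu> * shift_poly q (JY i) a
      - (\<Sum>k<N. of_real (G $$ (i, k)) * shift_poly q (JY k) a) = shift_poly q JW a"
    by (simp add: algebra_simps)
  moreover have "(\<Sum>k<N. shift_poly (balance_poly A b c \<mu> \<omega> G i k) (JY k) a)
      = (\<Sum>k<N. (if i = k then shift_poly p (JY k) a + \<mu> * shift_poly q (JY k) a else 0)
          - of_real (G $$ (i, k)) * shift_poly q (JY k) a)"
    by (intro sum.cong refl)
      (simp add: balance_poly_def shift_poly_diff shift_poly_add shift_poly_smult p_def q_def M_def shift_poly_uminus)
  ultimately show ?thesis
    using i by (simp add: sum_subtractf JY_def JW_def q_def)
qed

text \<open>Entry \<open>(i, r)\<close> of \<open>Q S Q^H = |q|^2 S_w I\<close>. The balance is used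
  with \<open>Z\<close> an output and again with \<open>Z\<close> an input. This cancels the mixed
  input-output correlations, which are only known to be bounded, before the window is
  removed.\<close>

lemma spectral_balance:
  fixes \<mu> :: complex and \<omega> :: real
  assumes i: "i < N" and r: "r < N"
  defines "Q \<equiv> \<lambda>i k. poly (balance_poly A b c \<mu> \<omega> G i k) 0"
  shows "(\<Sum>k<N. \<Sum>l<N. Q i k * cnj (Q r l) * S \<omega> $$ (k, l)) =
    (if i = r then of_real ((cmod (poly (node_num A b c \<mu> \<omega>) 0))\<^sup>2) *
       (\<integral>\<tau>. exp (- \<i> * of_real (\<omega> * \<tau>)) * of_real (Rw \<tau>) \<partial>lborel) else 0)"
proof -
  define q where "q = node_num A b c \<mu> \<omega>"
  define B where "B i k = balance_poly A b c \<mu> \<omega> G i k" for i k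
  let ?W = "coord w"
  let ?C = "\<lambda>U V. correlation P U V"
  have WW: "?C (?W k) (?W l) = (\<lambda>\<tau>. if k = l then Rw \<tau> else 0)" if "k < N" "l < N" for k l
    using is_cross_correlation_eq[OF w_correlation[OF that]] by simp
  have Rw_bounded: "bounded_borel Rw"
    using bounded_correlation[OF second_order_W second_order_W w_correlation, OF i i i i] WW[OF i i] Rw_integrable
    by (auto simp: bounded_borel_def)
  have bWW: "bounded_borel (?C (?W k) (?W l))" if "k < N" "l < N" for k l
    using Rw_bounded by (cases "k = l") (simp_all add: WW that bounded_borel_const)
  \<comment> \<open>Regularity was derived for correlations with a state or output as first
    argument; reflection transfers it to those with an input first.\<close>
  have WY: "?C (?W k) (Y l) = (\<lambda>\<tau>. ?C (Y l) (?W k) (- \<tau>))" if "k < N" "l < N" for k l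
    using cross_YW[OF that(2,1)] correlation_reflect by blast
  have bWY: "bounded_borel (?C (?W k) (Y l))" if "k < N" "l < N" for k l
  proof -
    have "bounded_borel (?C (Y l) (?W k))"
      using that by (intro correlation_Y_bounded_borel[OF second_order_W w_correlation] cross_XW)
    then show ?thesis
      unfolding WY[OF that] by (rule bounded_borel_reflect)
  qed
  have exact: "(\<Sum>k<N. \<Sum>l<N. shift_poly (adjoint_poly (B r l) * B i k) (damped_fourier \<epsilon> \<omega> (?C (Y k) (Y l))) 0)
      = shift_poly (adjoint_poly q * q) (damped_fourier \<epsilon> \<omega> (?C (?W i) (?W r))) 0"
    if \<epsilon>: "\<epsilon> \<noteq> 0" for \<epsilon>
  proof -
    define J where "J U V = damped_fourier \<epsilon> \<omega> (?C U V)" for U V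
    have first: "(\<Sum>k<N. shift_poly (B i k) (J (Y k) (Y l)) a) = shift_poly q (J (?W i) (Y l)) a"
      if l: "l < N" for l a
    proof -
      obtain R where "is_cross_correlation P (Y l) (Y l) R" by (rule output_cpsd[OF l l])
      from output_balance[OF second_order_Y[OF l] this cross_XY[OF _ _ l] bWY[OF _ l] \<epsilon> i]
      show ?thesis unfolding B_def q_def J_def .
    qed
    have "(\<Sum>l<N. shift_poly (B r l) (J (Y l) (?W i)) a) = shift_poly q (J (?W r) (?W i)) a" for a
      unfolding B_def q_def J_def
      by (rule output_balance[OF second_order_W[OF i] w_correlation[OF i i] cross_XW[OF _ _ i] bWW[OF _ i] \<epsilon> r])
    \<comment> \<open>Reflecting the lag exchanges the arguments of the correlations and replaces
      the polynomials by their adjoints.\<close>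
    from arg_cong[where f = "\<lambda>z. (-1) ^ a * cnj z" for a, OF this]
    have "(\<Sum>l<N. shift_poly (adjoint_poly (B r l)) (\<lambda>a. (-1) ^ a * cnj (J (Y l) (?W i) a)) a)
        = shift_poly (adjoint_poly q) (\<lambda>a. (-1) ^ a * cnj (J (?W r) (?W i) a)) a" for a
      by (simp add: shift_poly_adjoint sum_distrib_left)
    moreover have "(\<lambda>a. (-1) ^ a * cnj (J (Y l) (?W i) a)) = J (?W i) (Y l)" if "l < N" for l
      unfolding J_def WY[OF i that] by (rule ext, rule damped_fourier_reflect[symmetric])
    moreover have "(\<lambda>a. (-1) ^ a * cnj (J (?W r) (?W i) a)) = J (?W i) (?W r)"
    proof -
      have "?C (?W i) (?W r) = (\<lambda>\<tau>. ?C (?W r) (?W i) (- \<tau>))"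
        using correlation_reflect[OF w_correlation[OF r i]] by blast
      then show ?thesis
        unfolding J_def by (simp only:) (rule ext, rule damped_fourier_reflect[symmetric])
    qed
    ultimately have second: "(\<Sum>l<N. shift_poly (adjoint_poly (B r l)) (J (?W i) (Y l)) a)
        = shift_poly (adjoint_poly q) (J (?W i) (?W r)) a" for a
      by simp
    have "(\<Sum>k<N. \<Sum>l<N. shift_poly (adjoint_poly (B r l) * B i k) (J (Y k) (Y l)) 0)
        = (\<Sum>l<N. shift_poly (adjoint_poly (B r l)) (\<lambda>a. \<Sum>k<N. shift_poly (B i k) (J (Y k) (Y l)) a) 0)"
      by (subst sum.swap) (simp add: shift_poly_mult shift_poly_sum_seq)
    \<comment> \<open>Polynomials in the shift commute, so \<open>q\<close> can be moved outside,
      leaving inside the sum that \<open>second\<close> evaluates.\<close>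
    also have "\<dots> = (\<Sum>l<N. shift_poly (q * adjoint_poly (B r l)) (J (?W i) (Y l)) 0)"
      by (intro sum.cong refl) (simp add: first mult.commute[of q] shift_poly_mult)
    also have "\<dots> = shift_poly q (\<lambda>a. \<Sum>l<N. shift_poly (adjoint_poly (B r l)) (J (?W i) (Y l)) a) 0"
      by (simp add: shift_poly_mult shift_poly_sum_seq)
    also have "\<dots> = shift_poly (adjoint_poly q * q) (J (?W i) (?W r)) 0"
      by (simp add: second mult.commute[of _ q] shift_poly_mult)
    finally show ?thesis unfolding J_def .
  qed
  have YY: "(\<lambda>m. shift_poly p (damped_fourier (1 / Suc m) \<omega> (?C (Y k) (Y l))) 0) \<longlonglongrightarrow> poly p 0 * S \<omega> $$ (k, l)"
    if kl: "k < N" "l < N" for k l p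
  proof -
    obtain R where R: "is_cross_correlation P (Y k) (Y l) R" "integrable lborel R"
      "S \<omega> $$ (k, l) = (\<integral>\<tau>. exp (- \<i> * of_real (\<omega> * \<tau>)) * of_real (R \<tau>) \<partial>lborel)"
      by (rule output_cpsd[OF kl]) auto
    show ?thesis
      using shift_poly_damped_fourier_tendsto[OF R(2)] is_cross_correlation_eq[OF R(1)] R(3) by simp
  qed
  have lim: "(\<lambda>m. \<Sum>k<N. \<Sum>l<N. shift_poly (adjoint_poly (B r l) * B i k) (damped_fourier (1 / Suc m) \<omega> (?C (Y k) (Y l))) 0)
      \<longlonglongrightarrow> (\<Sum>k<N. \<Sum>l<N. poly (adjoint_poly (B r l) * B i k) 0 * S \<omega> $$ (k, l))"
    by (intro tendsto_sum YY) auto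
  have rhs: "(\<lambda>m. shift_poly (adjoint_poly q * q) (damped_fourier (1 / Suc m) \<omega> (?C (?W i) (?W r))) 0)
      \<longlonglongrightarrow> poly (adjoint_poly q * q) 0 *
        (if i = r then \<integral>\<tau>. exp (- \<i> * of_real (\<omega> * \<tau>)) * of_real (Rw \<tau>) \<partial>lborel else 0)"
  proof (cases "i = r")
    case True
    with WW[OF i r] have "?C (?W i) (?W r) = Rw" by simp
    with True show ?thesis by (simp only: refl if_True shift_poly_damped_fourier_tendsto[OF Rw_integrable])
  next
    case False
    with WW[OF i r] have "?C (?W i) (?W r) = (\<lambda>_. 0)" by simp
    with False show ?thesis by (simp add: shift_poly_def)
  qed
  \<comment> \<open>For each \<open>m\<close> the two sequences coincide by \<open>exact\<close>,
    hence so do their limits.\<close>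
  have "(\<Sum>k<N. \<Sum>l<N. poly (adjoint_poly (B r l) * B i k) 0 * S \<omega> $$ (k, l)) = poly (adjoint_poly q * q) 0 *
        (if i = r then \<integral>\<tau>. exp (- \<i> * of_real (\<omega> * \<tau>)) * of_real (Rw \<tau>) \<partial>lborel else 0)"
    by (rule LIMSEQ_unique[OF lim]) (use rhs in \<open>simp add: exact\<close>)
  then show ?thesis
    by (simp add: Q_def poly_adjoint_0 mult.commute[of "cnj _"] flip: B_def q_def complex_norm_square)
qed

end

section \<open>Reconstruction of the connectivity\<close>

text \<open>Kronecker products of eigenvectors of \<open>G\<close> and of the closed-loop node are network modes.\<close>

lemma char_poly_node_mat_nonzero:
  assumes A: "A \<in> carrier_mat n n" and b: "b \<in> carrier_vec n" and c: "c \<in> carrier_vec n"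
    and G: "G \<in> carrier_mat N N"
    and stable: "hurwitz (network_mat A b c G)"
    and \<mu>: "eigenvalue (map_mat complex_of_real G) \<mu>"
  shows "poly (char_poly (node_mat A b c \<mu> \<omega>)) 0 \<noteq> 0"
proof
  define M where "M = node_mat A b c \<mu> \<omega>"
  define F where "F = map_mat complex_of_real (network_mat A b c G)"
  have M: "M \<in> carrier_mat n n" using A by (simp add: M_def node_mat_def)
  have F: "F \<in> carrier_mat (N * n) (N * n)" using network_mat_carrier[OF A b c G] by (simp add: F_def)
  assume "poly (char_poly (node_mat A b c \<mu> \<omega>)) 0 = 0"
  \<comment> \<open>Because of the frequency shift in \<open>M\<close>, this says that
    \<open>A + \<mu> b c^T\<close> has the eigenvalue \<open>\<i> \<omega>\<close>; a network mode
    on the imaginary axis will contradict stability.\<close>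
  then have "eigenvalue M 0" using eigenvalue_root_char_poly[OF M] by (simp add: M_def)
  then obtain v where v: "v \<in> carrier_vec n" "v \<noteq> 0\<^sub>v n" and Mv: "M *\<^sub>v v = 0 \<cdot>\<^sub>v v"
    using M unfolding eigenvalue_def eigenvector_def by auto
  from \<mu> obtain z where z: "z \<in> carrier_vec N" "z \<noteq> 0\<^sub>v N"
    and Gz: "map_mat complex_of_real G *\<^sub>v z = \<mu> \<cdot>\<^sub>v z"
    using G unfolding eigenvalue_def eigenvector_def by auto
  obtain r0 where r0: "r0 < n" "v $ r0 \<noteq> 0" using v by (metis eq_vecI carrier_vecD index_zero_vec)
  obtain i0 where i0: "i0 < N" "z $ i0 \<noteq> 0" using z by (metis eq_vecI carrier_vecD index_zero_vec)
  define u where "u = vec (N * n) (\<lambda>a. z $ (a div n) * v $ (a mod n))"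
  have u: "u $ (i * n + r) = z $ i * v $ r" if "i < N" "r < n" for i r
    using that block_index_less[OF that] by (simp add: u_def)
  have F_index: "F $$ (i * n + r, k * n + s)
      = (if i = k then of_real (A $$ (r, s)) else 0) + of_real (G $$ (i, k)) * of_real (b $ r * c $ s)"
    if "i < N" "k < N" "r < n" "s < n" for i k r s
    using network_mat_index[OF A b c G that] network_mat_carrier[OF A b c G]
      block_index_less[OF that(1,3)] block_index_less[OF that(2,4)]
    by (simp add: F_def)
  have node: "(\<Sum>s<n. of_real (A $$ (r, s)) * v $ s) + \<mu> * of_real (b $ r) * (\<Sum>s<n. of_real (c $ s) * v $ s)
      = \<i> * of_real \<omega> * v $ r" if r: "r < n" for r
  proof -
    have "0 = (M *\<^sub>v v) $ r" using Mv v r by simp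
    also have "\<dots> = (\<Sum>s<n. M $$ (r, s) * v $ s)"
      using M v r by (simp add: scalar_prod_def lessThan_atLeast0)
    also have "\<dots> = (\<Sum>s<n. of_real (A $$ (r, s)) * v $ s + \<mu> * of_real (b $ r) * (of_real (c $ s) * v $ s)
        - (if r = s then \<i> * of_real \<omega> * v $ s else 0))"
      using A r by (intro sum.cong refl) (simp add: M_def node_mat_def algebra_simps)
    also have "\<dots> = (\<Sum>s<n. of_real (A $$ (r, s)) * v $ s)
        + \<mu> * of_real (b $ r) * (\<Sum>s<n. of_real (c $ s) * v $ s) - \<i> * of_real \<omega> * v $ r"
      using r by (simp add: sum_subtractf sum.distrib sum_distrib_left)
    finally show ?thesis by (simp add: algebra_simps)
  qed
  have gain: "(\<Sum>k<N. of_real (G $$ (i, k)) * z $ k) = \<mu> * z $ i" if i: "i < N" for i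
  proof -
    have "(\<Sum>k<N. of_real (G $$ (i, k)) * z $ k) = (map_mat complex_of_real G *\<^sub>v z) $ i"
      using G z i by (simp add: scalar_prod_def lessThan_atLeast0)
    then show ?thesis using Gz z i by simp
  qed
  have mode: "(F *\<^sub>v u) $ (i * n + r) = \<i> * of_real \<omega> * u $ (i * n + r)" if i: "i < N" and r: "r < n" for i r
  proof -
    let ?cv = "\<Sum>s<n. of_real (c $ s) * v $ s"
    have "(F *\<^sub>v u) $ (i * n + r) = (\<Sum>a<N * n. F $$ (i * n + r, a) * u $ a)"
      using F block_index_less[OF i r] by (simp add: scalar_prod_def lessThan_atLeast0 u_def)
    also have "\<dots> = (\<Sum>k<N. \<Sum>s<n. F $$ (i * n + r, k * n + s) * u $ (k * n + s))"
      by (rule sum_blocks)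
    also have "\<dots> = (\<Sum>k<N. \<Sum>s<n. (if i = k then z $ k * (of_real (A $$ (r, s)) * v $ s) else 0)
        + of_real (b $ r) * (of_real (G $$ (i, k)) * z $ k) * (of_real (c $ s) * v $ s))"
      by (intro sum.cong refl) (simp add: F_index[OF i _ r] u, simp add: algebra_simps)
    also have "\<dots> = (\<Sum>k<N. (if i = k then z $ k * (\<Sum>s<n. of_real (A $$ (r, s)) * v $ s) else 0)
        + of_real (b $ r) * (of_real (G $$ (i, k)) * z $ k) * ?cv)"
      by (intro sum.cong refl) (simp add: sum.distrib sum_distrib_left)
    also have "\<dots> = z $ i * (\<Sum>s<n. of_real (A $$ (r, s)) * v $ s)
        + of_real (b $ r) * (\<Sum>k<N. of_real (G $$ (i, k)) * z $ k) * ?cv"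
      using i by (simp add: sum.distrib flip: sum_distrib_left sum_distrib_right)
    also have "\<dots> = z $ i * ((\<Sum>s<n. of_real (A $$ (r, s)) * v $ s) + \<mu> * of_real (b $ r) * ?cv)"
      unfolding gain[OF i] by (simp add: algebra_simps)
    finally show ?thesis by (simp add: node[OF r] u[OF i r])
  qed
  have "eigenvector F u (\<i> * of_real \<omega>)"
    unfolding eigenvector_def
  proof (intro conjI)
    show "u \<in> carrier_vec (dim_row F)" using F by (simp add: u_def)
    show "u \<noteq> 0\<^sub>v (dim_row F)"
      using u[OF i0(1) r0(1)] i0 r0 block_index_less[OF i0(1) r0(1)] F by auto
    show "F *\<^sub>v u = \<i> * of_real \<omega> \<cdot>\<^sub>v u"
    proof (rule eq_vecI)
      fix a assume "a < dim_vec (\<i> * of_real \<omega> \<cdot>\<^sub>v u)"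
      then have a: "a < N * n" by (simp add: u_def)
      then have "a div n < N" "a mod n < n"
        using r0(1) by (simp_all add: less_mult_imp_div_less)
      from mode[OF this] a show "(F *\<^sub>v u) $ a = (\<i> * of_real \<omega> \<cdot>\<^sub>v u) $ a"
        by (simp add: u_def)
    qed (use F in \<open>simp add: u_def\<close>)
  qed
  then have "eigenvalue F (\<i> * of_real \<omega>)" unfolding eigenvalue_def by blast
  then have "Re (\<i> * of_real \<omega>) < 0" using stable unfolding hurwitz_def F_def by blast
  then show False by simp
qed

section \<open>Inverting a matrix through a congruence\<close>

lemma matinv_eqI:
  assumes S: "S \<in> carrier_mat d d" and V: "V \<in> carrier_mat d d" and SV: "S * V = 1\<^sub>m d"
  shows "matinv S = V"
proof -
  have VS: "V * S = 1\<^sub>m d" by (rule mat_mult_left_right_inverse[OF S V SV])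
  \<comment> \<open>Being a unit of the matrix ring excludes the result \<open>None\<close>, so
    \<open>the\<close> is applied to a genuine inverse.\<close>
  have "S \<in> Units (ring_mat TYPE(complex) d ())"
    using S V SV VS unfolding Units_def by (auto simp: ring_mat_simps)
  then obtain B where B: "mat_inverse S = Some B"
    using mat_inverse(1)[OF S, of "()"] by (cases "mat_inverse S") auto
  then have "B * S = 1\<^sub>m d" "B \<in> carrier_mat d d" using mat_inverse(2)[OF S] by auto
  then have "B = B * (S * V)" using SV by simp
  also have "\<dots> = (B * S) * V"
    using \<open>B \<in> carrier_mat d d\<close> S V by (simp add: assoc_mult_mat)
  also have "\<dots> = V" using \<open>B * S = 1\<^sub>m d\<close> V by simp
  finally show ?thesis using B by simp
qed

text \<open>From \<open>Q S Q^H = \<kappa> I\<close> follows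
  \<open>S^(-1) = Q^H Q / \<kappa>\<close>, whose diagonal holds the squared column norms of
  \<open>Q\<close> over \<open>\<kappa>\<close>. Deleting row \<open>j\<close> of \<open>Q\<close>
  therefore removes a single term from each of the other columns.\<close>

lemma matinv_diag_of_congruence:
  fixes Q :: "nat \<Rightarrow> nat \<Rightarrow> complex"
  assumes S: "S \<in> carrier_mat d d" and \<kappa>: "\<kappa> \<noteq> 0" and i: "i < d"
    and congr: "\<And>i r. i < d \<Longrightarrow> r < d \<Longrightarrow>
      (\<Sum>k<d. \<Sum>l<d. Q i k * cnj (Q r l) * S $$ (k, l)) = (if i = r then \<kappa> else 0)"
  shows "matinv S $$ (i, i) = of_real (\<Sum>k<d. (cmod (Q k i))\<^sup>2) / \<kappa>"
proof -
  define U where "U = mat d d (\<lambda>(i, k). Q i k)"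
  define H where "H = mat d d (\<lambda>(l, r). cnj (Q r l))"
  have U: "U \<in> carrier_mat d d" and H: "H \<in> carrier_mat d d" by (simp_all add: U_def H_def)
  have USH: "U * (S * H) = \<kappa> \<cdot>\<^sub>m 1\<^sub>m d"
  proof (rule eq_matI)
    fix i r assume "i < dim_row (\<kappa> \<cdot>\<^sub>m 1\<^sub>m d)" "r < dim_col (\<kappa> \<cdot>\<^sub>m 1\<^sub>m d)"
    then have ir: "i < d" "r < d" by simp_all
    then have "(U * (S * H)) $$ (i, r) = (\<Sum>k<d. \<Sum>l<d. Q i k * cnj (Q r l) * S $$ (k, l))"
      using S by (simp add: U_def H_def scalar_prod_def lessThan_atLeast0 sum_distrib_left ac_simps)
    then show "(U * (S * H)) $$ (i, r) = (\<kappa> \<cdot>\<^sub>m 1\<^sub>m d) $$ (i, r)" using congr ir by simp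
  qed (use U H S in auto)
  define T where "T = (1 / \<kappa>) \<cdot>\<^sub>m (S * H)"
  have T: "T \<in> carrier_mat d d" using S H by (simp add: T_def)
  have "U * T = (1 / \<kappa>) \<cdot>\<^sub>m (U * (S * H))"
    unfolding T_def by (rule mult_smult_distrib[OF U mult_carrier_mat[OF S H]])
  also have "\<dots> = 1\<^sub>m d" unfolding USH using \<kappa> by (intro eq_matI) auto
  \<comment> \<open>A one-sided inverse of a square matrix is two-sided; this moves \<open>U\<close>
    to the right end of the product and isolates \<open>S\<close>.\<close>
  finally have "T * U = 1\<^sub>m d" by (rule mat_mult_left_right_inverse[OF U T])
  moreover have "T * U = (1 / \<kappa>) \<cdot>\<^sub>m (S * (H * U))"
    unfolding T_def using S H U by (simp add: mult_smult_assoc_mat[of _ d d] assoc_mult_mat[of _ d d _ d _ d])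
  moreover have "\<dots> = S * ((1 / \<kappa>) \<cdot>\<^sub>m (H * U))"
    by (rule mult_smult_distrib[symmetric, OF S mult_carrier_mat[OF H U]])
  ultimately have "S * ((1 / \<kappa>) \<cdot>\<^sub>m (H * U)) = 1\<^sub>m d" by simp
  then have "matinv S = (1 / \<kappa>) \<cdot>\<^sub>m (H * U)"
    using H U by (intro matinv_eqI[OF S]) simp_all
  then show ?thesis
    using i by (simp add: U_def H_def scalar_prod_def lessThan_atLeast0 mult.commute[of "cnj _"]
        flip: complex_norm_square)
qed

text \<open>Separates, in a column of \<open>Q\<close>, the entry at the grounded node from those
  kept by the grounded network.\<close>

lemma sum_insert_index:
  fixes f :: "nat \<Rightarrow> 'a::comm_monoid_add"
  assumes "j < N"
  shows "(\<Sum>k<N. f k) = f j + (\<Sum>k<N - 1. f (insert_index j k))"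
proof -
  have "{..<N} - {j} = insert_index j ` {..<N - 1}"
  proof
    show "{..<N} - {j} \<subseteq> insert_index j ` {..<N - 1}"
    proof
      fix k assume "k \<in> {..<N} - {j}"
      with assms have "k = insert_index j (delete_index j k)" "delete_index j k < N - 1"
        by (auto simp: insert_delete_index delete_index_def)
      then show "k \<in> insert_index j ` {..<N - 1}" by blast
    qed
    show "insert_index j ` {..<N - 1} \<subseteq> {..<N} - {j}"
      using assms by (auto simp: insert_index_def split: if_splits)
  qed
  then have "(\<Sum>k\<in>{..<N} - {j}. f k) = (\<Sum>k<N - 1. f (insert_index j k))"
    by (simp add: sum.reindex insert_index_inj_on)
  then show ?thesis using assms sum.remove[of "{..<N}" j f] by simp
qed

text \<open>Indices start at 0, but a node \<open>i > j\<close> still moves to position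
  \<open>i - 1\<close> after grounding. The inverses have complex entries, so the root is the
  principal \<open>csqrt\<close>, which returns the weight itself because weights are nonnegative.
  Invertibility of \<open>S\<close> at the chosen frequency gives its inverse a meaning and forces
  \<open>q\<close> to be nonzero there.\<close>

theorem theorem7:
  fixes P :: "'a measure"
    and N n j :: nat
    and A G :: "real mat" and b c :: "real vec"
    and w x x' :: "real \<Rightarrow> 'a \<Rightarrow> real vec"
    and Rw Sw :: "real \<Rightarrow> real" and S S' :: "real \<Rightarrow> complex mat"
    and \<Omega> \<omega>\<^sub>0 :: real
  assumes prob: "prob_space P"
    and A: "A \<in> carrier_mat n n" and b: "b \<in> carrier_vec n" and c: "c \<in> carrier_vec n"
    and G: "G \<in> carrier_mat N N"
    and G_nonneg: "\<And>i k. i < N \<Longrightarrow> k < N \<Longrightarrow> 0 \<le> G $$ (i, k)"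
    and stable: "hurwitz (network_mat A b c G)"
    and w_zero_mean: "\<And>i. i < N \<Longrightarrow> zero_mean P (coord w i)"
    and w_stationary: "\<And>i. i < N \<Longrightarrow> wide_sense_stationary P (coord w i)"
    and w_uncorrelated:
      "\<And>i k. i < N \<Longrightarrow> k < N \<Longrightarrow> i \<noteq> k \<Longrightarrow> uncorrelated P (coord w i) (coord w k)"
    and w_autocorrelation: "\<And>i. i < N \<Longrightarrow> is_cross_correlation P (coord w i) (coord w i) Rw"
    and w_psd: "\<And>i. i < N \<Longrightarrow> has_psd P (coord w i) Sw"
    and \<Omega>: "0 < \<Omega>"
    and Sw_pos: "\<And>\<omega>. \<omega> \<in> {-\<Omega><..<\<Omega>} \<Longrightarrow> 0 < Sw \<omega>"
    and network: "network_response P A b c G w x"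
    and S: "has_cpsd_matrix P N (network_output N c x) S"
    and j: "j < N"
    and grounded: "network_response P A b c (mat_delete G j j) (drop_coord j w) x'"
    and S': "has_cpsd_matrix P (N - 1) (network_output (N - 1) c x') S'"
    and \<omega>\<^sub>0: "\<omega>\<^sub>0 \<in> {-\<Omega><..<\<Omega>}"
    and S_invertible: "invertible_mat (S \<omega>\<^sub>0)"
  shows "\<forall>i<N.
     (i < j \<longrightarrow> complex_of_real (G $$ (j, i)) =
        csqrt (complex_of_real (Sw \<omega>\<^sub>0) *
          (matinv (S \<omega>\<^sub>0) $$ (i, i) - matinv (S' \<omega>\<^sub>0) $$ (i, i)))) \<and>
     (i > j \<longrightarrow> complex_of_real (G $$ (j, i)) =
        csqrt (complex_of_real (Sw \<omega>\<^sub>0) *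
          (matinv (S \<omega>\<^sub>0) $$ (i, i) - matinv (S' \<omega>\<^sub>0) $$ (i - 1, i - 1))))"
proof (intro allI impI)
  have N: "N \<noteq> 0" using j by simp
  \<comment> \<open>Any complex eigenvalue of \<open>G\<close> will do as gain; one exists because
    \<open>N\<close> is positive.\<close>
  have "spectrum (map_mat complex_of_real G) \<noteq> {}"
    using G N by (intro spectrum_non_empty[of _ N]) auto
  then obtain \<mu> where \<mu>: "eigenvalue (map_mat complex_of_real G) \<mu>"
    unfolding spectrum_def by auto
  define p where "p = poly (char_poly (node_mat A b c \<mu> \<omega>\<^sub>0)) 0"
  define q where "q = poly (node_num A b c \<mu> \<omega>\<^sub>0) 0"
  have p: "p \<noteq> 0"
    unfolding p_def by (rule char_poly_node_mat_nonzero[OF A b c G stable \<mu>])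
  obtain R where R: "is_cross_correlation P (coord w j) (coord w j) R" "integrable lborel R"
    and Sw_R: "\<And>\<omega>. complex_of_real (Sw \<omega>) = (\<integral>\<tau>. exp (- \<i> * of_real (\<omega> * \<tau>)) * of_real (R \<tau>) \<partial>lborel)"
    using w_psd[OF j] unfolding has_psd_def has_cpsd_def by blast
  have "R = Rw"
    using is_cross_correlation_eq[OF R(1)] is_cross_correlation_eq[OF w_autocorrelation[OF j]] by simp
  note Rw = R(2)[unfolded this] and Sw_Rw = Sw_R[unfolded this]
  have w_correlation: "is_cross_correlation P (coord w i) (coord w k) (\<lambda>\<tau>. if i = k then Rw \<tau> else 0)"
    if "i < N" "k < N" for i k
  proof (cases "i = k")
    case False
    with w_uncorrelated[OF that] w_zero_mean[OF that(1)] show ?thesis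
      by (simp add: is_cross_correlation_def uncorrelated_def zero_mean_def)
  qed (use w_autocorrelation that in simp)
  interpret full: white_network P N n A G b c w x Rw S
    by unfold_locales (fact A b c G w_correlation Rw network S)+
  define G' where "G' = mat_delete G j j"
  have G': "G' \<in> carrier_mat (N - 1) (N - 1)" using mat_delete_carrier[OF G] by (simp add: G'_def)
  have ins_less: "insert_index j i < N" if "i < N - 1" for i
    using that by (auto simp: insert_index_def)
  have ins_eq: "insert_index j i = insert_index j k \<longleftrightarrow> i = k" for i k
    using delete_insert_index by metis
  have w': "coord (drop_coord j w) i t \<xi> = coord w (insert_index j i) t \<xi>"
    if "i < N - 1" "\<xi> \<in> space P" for i t \<xi>
    using full.responseD(2)[OF that(2), of t] that(1) by (simp add: coord_def drop_coord_def)
  have w'_correlation: "is_cross_correlation P (coord (drop_coord j w) i) (coord (drop_coord j w) k)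
      (\<lambda>\<tau>. if i = k then Rw \<tau> else 0)" if "i < N - 1" "k < N - 1" for i k
    using w_correlation[OF ins_less[OF that(1)] ins_less[OF that(2)]]
      is_cross_correlation_cong[where P = P, OF w'[OF that(1)] w'[OF that(2)]] by (simp add: ins_eq)
  interpret grounded: white_network P "N - 1" n A G' b c "drop_coord j w" x' Rw S'
    by unfold_locales (fact A b c G' w'_correlation Rw grounded[folded G'_def] S')+
  define Q where "Q i k = poly (balance_poly A b c \<mu> \<omega>\<^sub>0 G i k) 0" for i k
  define Q' where "Q' i k = poly (balance_poly A b c \<mu> \<omega>\<^sub>0 G' i k) 0" for i k
  have Q: "Q i k = (if i = k then p + \<mu> * q else 0) - of_real (G $$ (i, k)) * q" for i k
    by (simp add: Q_def balance_poly_def p_def q_def)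
  \<comment> \<open>The node polynomials do not involve \<open>G\<close>, and the same
    \<open>\<mu>\<close> is used, so grounding just deletes row and column \<open>j\<close> of
    \<open>Q\<close>.\<close>
  have Q': "Q' i k = Q (insert_index j i) (insert_index j k)" if "i < N - 1" "k < N - 1" for i k
    using that G mat_delete_index[of G "N - 1" j j i k] j
    by (simp add: Q Q'_def balance_poly_def p_def q_def ins_eq G'_def)
  define \<kappa> where "\<kappa> = complex_of_real ((cmod q)\<^sup>2 * Sw \<omega>\<^sub>0)"
  have S_carrier: "S \<omega>\<^sub>0 \<in> carrier_mat N N" and S'_carrier: "S' \<omega>\<^sub>0 \<in> carrier_mat (N - 1) (N - 1)"
    using S S' by (simp_all add: has_cpsd_matrix_def)
  have congr: "(\<Sum>k<N. \<Sum>l<N. Q i k * cnj (Q r l) * S \<omega>\<^sub>0 $$ (k, l)) = (if i = r then \<kappa> else 0)"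
    if "i < N" "r < N" for i r
    using full.spectral_balance[OF that, of \<mu> \<omega>\<^sub>0] by (simp add: Q_def \<kappa>_def q_def Sw_Rw)
  have congr': "(\<Sum>k<N - 1. \<Sum>l<N - 1. Q' i k * cnj (Q' r l) * S' \<omega>\<^sub>0 $$ (k, l)) = (if i = r then \<kappa> else 0)"
    if "i < N - 1" "r < N - 1" for i r
    using grounded.spectral_balance[OF that, of \<mu> \<omega>\<^sub>0] by (simp add: Q'_def \<kappa>_def q_def Sw_Rw)
  \<comment> \<open>If \<open>q\<close> vanished, then \<open>Q = p I\<close> and
    \<open>\<kappa> = 0\<close>, so the balance would read \<open>|p|^2 S = 0\<close>. As
    \<open>p\<close> is nonzero, \<open>S\<close> would be the zero matrix, contradicting its
    invertibility.\<close>
  have q: "q \<noteq> 0"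
  proof
    assume q0: "q = 0"
    have zero: "S \<omega>\<^sub>0 $$ (i, r) = 0" if "i < N" "r < N" for i r
    proof -
      have inner: "(\<Sum>l<N. Q i k * cnj (Q r l) * S \<omega>\<^sub>0 $$ (k, l)) = Q i k * cnj p * S \<omega>\<^sub>0 $$ (k, r)" for k
      proof -
        have "(\<Sum>l<N. Q i k * cnj (Q r l) * S \<omega>\<^sub>0 $$ (k, l))
            = (\<Sum>l<N. if r = l then Q i k * cnj p * S \<omega>\<^sub>0 $$ (k, l) else 0)"
          by (intro sum.cong refl) (simp add: Q[of r] q0)
        then show ?thesis using that by simp
      qed
      have "(\<Sum>k<N. \<Sum>l<N. Q i k * cnj (Q r l) * S \<omega>\<^sub>0 $$ (k, l))
          = (\<Sum>k<N. if i = k then p * cnj p * S \<omega>\<^sub>0 $$ (k, r) else 0)"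
        unfolding inner by (intro sum.cong refl) (simp add: Q q0)
      also have "\<dots> = p * cnj p * S \<omega>\<^sub>0 $$ (i, r)" using that by simp
      finally show ?thesis using congr[OF that] p q0 by (simp add: \<kappa>_def split: if_splits)
    qed
    obtain B where B: "S \<omega>\<^sub>0 * B = 1\<^sub>m N" "B * S \<omega>\<^sub>0 = 1\<^sub>m (dim_row B)"
      using S_invertible S_carrier unfolding invertible_mat_def inverts_mat_def by auto
    \<comment> \<open>The dimensions of \<open>B\<close> have to be recovered by comparing both
      sides of the two inverse equations.\<close>
    from arg_cong[where f = dim_row, OF B(2)] arg_cong[where f = dim_col, OF B(1)]
      arg_cong[where f = dim_col, OF B(2)]
    have "B \<in> carrier_mat N N" using S_carrier by auto
    then have "(S \<omega>\<^sub>0 * B) $$ (j, j) = (\<Sum>k<N. S \<omega>\<^sub>0 $$ (j, k) * B $$ (k, j))"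
      using S_carrier j by (simp add: scalar_prod_def lessThan_atLeast0)
    then show False using B(1) zero j by simp
  qed
  have Sw: "0 < Sw \<omega>\<^sub>0" by (rule Sw_pos[OF \<omega>\<^sub>0])
  have \<kappa>: "\<kappa> \<noteq> 0" using q Sw by (simp add: \<kappa>_def)
  have key: "complex_of_real (G $$ (j, insert_index j i)) =
      csqrt (complex_of_real (Sw \<omega>\<^sub>0) *
        (matinv (S \<omega>\<^sub>0) $$ (insert_index j i, insert_index j i) - matinv (S' \<omega>\<^sub>0) $$ (i, i)))"
    if i: "i < N - 1" for i
  proof -
    let ?i = "insert_index j i"
    \<comment> \<open>The entry is off the diagonal, so the term \<open>p + \<mu> * q\<close> is
      absent and only the coupling weight times \<open>q\<close> remains.\<close>
    have "j \<noteq> ?i" by (auto simp: insert_index_def)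
    then have Qj: "(cmod (Q j ?i))\<^sup>2 = (G $$ (j, ?i))\<^sup>2 * (cmod q)\<^sup>2"
      by (simp add: Q norm_mult power_mult_distrib)
    have "matinv (S' \<omega>\<^sub>0) $$ (i, i) = of_real (\<Sum>k<N - 1. (cmod (Q (insert_index j k) ?i))\<^sup>2) / \<kappa>"
      using matinv_diag_of_congruence[OF S'_carrier \<kappa> i congr'] Q' i by simp
    moreover have "matinv (S \<omega>\<^sub>0) $$ (?i, ?i)
        = of_real ((cmod (Q j ?i))\<^sup>2 + (\<Sum>k<N - 1. (cmod (Q (insert_index j k) ?i))\<^sup>2)) / \<kappa>"
      using matinv_diag_of_congruence[OF S_carrier \<kappa> ins_less[OF i] congr]
      by (simp add: sum_insert_index[OF j])
    ultimately have "matinv (S \<omega>\<^sub>0) $$ (?i, ?i) - matinv (S' \<omega>\<^sub>0) $$ (i, i)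
        = of_real ((G $$ (j, ?i))\<^sup>2 * (cmod q)\<^sup>2) / \<kappa>"
      by (simp add: Qj add_divide_distrib)
    also have "\<dots> = of_real ((G $$ (j, ?i))\<^sup>2 / Sw \<omega>\<^sub>0)"
      using q by (simp add: \<kappa>_def)
    finally have "complex_of_real (Sw \<omega>\<^sub>0) * (matinv (S \<omega>\<^sub>0) $$ (?i, ?i) - matinv (S' \<omega>\<^sub>0) $$ (i, i))
        = of_real ((G $$ (j, ?i))\<^sup>2)"
      using Sw by simp
    then show ?thesis
      using G_nonneg[OF j ins_less[OF i]] by (simp only: of_real_power) (rule csqrt_square[symmetric], auto)
  qed
  fix i assume i: "i < N"
  show "(i < j \<longrightarrow> complex_of_real (G $$ (j, i)) =
        csqrt (complex_of_real (Sw \<omega>\<^sub>0) *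
          (matinv (S \<omega>\<^sub>0) $$ (i, i) - matinv (S' \<omega>\<^sub>0) $$ (i, i)))) \<and>
     (i > j \<longrightarrow> complex_of_real (G $$ (j, i)) =
        csqrt (complex_of_real (Sw \<omega>\<^sub>0) *
          (matinv (S \<omega>\<^sub>0) $$ (i, i) - matinv (S' \<omega>\<^sub>0) $$ (i - 1, i - 1))))"
    \<comment> \<open>\<open>insert_index j\<close> fixes \<open>i\<close> when
      \<open>i < j\<close>, and sends \<open>i - 1\<close> to \<open>i\<close> when
      \<open>i > j\<close>.\<close>
    using key[of i] key[of "i - 1"] i j by auto
qed

end
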